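(* Let $\ell\ge1$ be an integer and $a\in\mathbb C^*$. Parametrize, via the bijection $\Pi$, the basis of the extremal fundamental loop weight module $V(Y_{\ell,a}Y_{0,aq^\ell}^{-1})$ by the set $\mathcal T_{[1,\ell]}$, writing $T_a$ for the basis vector $S_a\otimes S'_{aq^\ell}$ with $\Pi(S\otimes S')=T$. Then the action of $\mathcal U_q(\hat{sl}_\infty)$ on $V(Y_{\ell,a}Y_{0,aq^\ell}^{-1})$ is given, for all $T=(i_1<i_2<\cdots<i_\ell)\in\mathcal T_{[1,\ell]}$ and $i\in\mathbb Z$, by $$x_i^+(z)\cdot T_a=\sum_{1\le p\le\ell}\delta_{\{i_p=i+1\}}\,\delta(aq^{i+\ell+1-2p}z)\,(\tilde e_i\cdot T)_a,$$ $$x_i^-(z)\cdot T_a=\sum_{1\le p\le\ell}\delta_{\{i_p=i\}}\,\delta(aq^{i+\ell+1-2p}z)\,(\tilde f_i\cdot T)_a,$$ $$\phi_i^\pm(z)\cdot T_a=\begin{cases}\psi(aq^{i+\ell+3-2p}z)^{-1}\,T_a&\text{if there is }1\le p\le\ell\text{ with }i_p=i+1\text{ and }i_{p-1}\ne i,\\ \psi(aq^{i+\ell+1-2p}z)\,T_a&\text{if there is }1\le p\le\ell\text{ with }i_p=i\text{ and }i_{p+1}\neq i+1,\\ T_a&\text{otherwise,}\end{cases}$$ where the condition $i_{p-1}\neq i$ is void for $p=1$, the condition $i_{p+1}\ne i+1$ is void for $p=\ell$, $0_a=0$, and rational functions are expanded in powers of $z^{\pm1}$ for $\phi_i^\pm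$.
   Context: Algebra. Fix $t\in\mathbb C$ such that $q=e^{t}$ is not a root of unity, and put $q^{r}=e^{tr}$ for $r\in\mathbb Q$. For $i,j\in\mathbb Z$ let $C_{ii}=2$, $C_{i,i\pm1}=-1$, $C_{ij}=0$ otherwise; $\mathfrak h=\bigoplus_{i\in\mathbb Z}\mathbb Q h_i$; $\Lambda_i\in\mathfrak h^*$ with $\Lambda_i(h_j)=\delta_{ij}$; $\alpha_i=2\Lambda_i-\Lambda_{i-1}-\Lambda_{i+1}$. The algebra $\mathcal U_q(\hat{sl}_\infty)$ is the $\mathbb C$-algebra generated by $x_{i,r}^{\pm}$ ($i,r\in\mathbb Z$), $k_h$ ($h\in\mathfrak h$), $h_{i,m}$ ($i\in\mathbb Z$, $m\in\mathbb Z\setminus\{0\}$). With $x_i^\pm(z)=\sum_{r}x_{i,r}^\pm z^r$, $\phi_i^\pm(z)=\sum_{m\ge0}\phi^\pm_{i,\pm m}z^{\pm m}=k_{\pm h_i}\exp(\pm(q-q^{-1})\sum_{m\ge1}h_{i,\pm m}z^{\pm m})$, $\delta(z)=\sum_{s\in\mathbb Z}z^s$, the relations are: $k_hk_{h'}=k_{h+h'}$, $k_0=1$; all $k_h$ and all coefficients of the $\phi_i^\pm(z)$ commute; $k_hx_j^\pm(z)k_{-h}=q^{\pm\alpha_j(h)}x_j^\pm(z)$; for $\epsilon\in\{+,-\}$, $(w-q^{\pm C_{ij}}z)\phi_i^{\epsilon}(z)x_j^\pm(w)=(q^{\pm C_{ij}}w-z)x_j^\pm(w)\phi_i^{\epsilon}(z)$;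 $[x_i^+(z),x_j^-(w)]=\frac{\delta_{ij}}{q-q^{-1}}\big(\delta(w/z)\phi_i^+(w)-\delta(z/w)\phi_i^-(z)\big)$; $(w-q^{\pm C_{ij}}z)x_i^\pm(z)x_j^\pm(w)=(q^{\pm C_{ij}}w-z)x_j^\pm(w)x_i^\pm(z)$; for $|i-j|=1$, $x_i^\pm(z_1)x_i^\pm(z_2)x_j^\pm(w)-(q+q^{-1})x_i^\pm(z_1)x_j^\pm(w)x_i^\pm(z_2)+x_j^\pm(w)x_i^\pm(z_1)x_i^\pm(z_2)+(z_1\leftrightarrow z_2)=0$; and $[x_i^\pm(z),x_j^\pm(w)]=0$ for $|i-j|\ge2$. Fundamental modules. Put $\psi(z)=\frac{q-q^{-1}z}{1-z}$. Let $\mathcal T_\ell^+$ be the set of strictly increasing integer sequences $T=(\cdots<i_{\ell-1}<i_\ell)$ indexed by $p\le\ell$ with $i_p=p$ for $p\ll0$; let $\mathcal T_0^-$ be the set of strictly increasing sequences $T=(i_{1}<i_{2}<\cdots)$ indexed by $p\ge1$ with $i_p=p$ for $p\gg0$; let $\mathcal T_{[1,\ell]}$ be the set of strictly increasing integer sequences $(i_1<\cdots<i_\ell)$. For such $T$, $\tilde e_iT$ is obtained by replacing the entry $i+1$ by $i$ (and is $0$ if $i+1\notin T$ or $i\in T$), and $\tilde f_iT$ by replacing $i$ by $i+1$ (and is $0$ if $i\notin T$ or $i+1\in T$). The modules $V(Y_{\ell,b})$ (fundamental $\ell$-highest weight) and $V(Y_{0,b}^{-1})$ (fundamental $\ell$-lowest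 weight), $b\in\mathbb C^*$, have bases $\{T_b\}$ indexed by $\mathcal T_\ell^+$, respectively $\mathcal T_0^-$, with action (put $N=\ell$, respectively $N=0$): $x_i^+(z)T_b=\sum_p\delta_{\{i_p=i+1\}}\delta(bq^{i+N+1-2p}z)(\tilde e_iT)_b$; $x_i^-(z)T_b=\sum_p\delta_{\{i_p=i\}}\delta(bq^{i+N+1-2p}z)(\tilde f_iT)_b$; $\phi_i^\pm(z)T_b=\psi(bq^{i+N+3-2p}z)^{-1}T_b$ if $i_p=i+1$ for some $p$ and $i\notin T$; $=\psi(bq^{i+N+1-2p}z)T_b$ if $i_p=i$ for some $p$ and $i+1\notin T$; $=T_b$ otherwise. Drinfeld coproduct: $\Delta(x_i^+(z))=x_i^+(z)\otimes1+\phi_i^-(z)\otimes x_i^+(z)$, $\Delta(x_i^-(z))=x_i^-(z)\otimes\phi_i^+(z)+1\otimes x_i^-(z)$, $\Delta(\phi_i^\pm(z))=\phi_i^\pm(z)\otimes\phi_i^\pm(z)$, where a product of a rational function $f(z)$ and $\delta(cz)$ is understood as $f(c^{-1})\delta(cz)$ (when $f$ has no pole at $c^{-1}$). It makes $V(Y_{\ell,a})\otimes V(Y_{0,aq^\ell}^{-1})$ into a $\mathcal U_q(\hat{sl}_\infty)$-module. For $T=(i_p)_{p\le\ell}\in\mathcal T_\ell^+$ put $\alpha_T=\sup\{p\le\ell: i_p=p\}$; for $T'=(j_p)_{p\ge1}\in\mathcal T_0^-$ put $\beta_{T'}=\inf\{p\ge1: j_p=p\}$. Let $\mathcal T_\ell$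 be the set of pairs $T\otimes T'$ with $T\in\mathcal T_\ell^+$, $T'\in\mathcal T_0^-$, $\alpha_T\ge\beta_{T'}-1$. The extremal fundamental loop weight module $V(Y_{\ell,a}Y_{0,aq^\ell}^{-1})$ is the submodule of $V(Y_{\ell,a})\otimes V(Y_{0,aq^\ell}^{-1})$ spanned by the vectors $T_a\otimes T'_{aq^\ell}$ with $T\otimes T'\in\mathcal T_\ell$. The bijection $\Pi:\mathcal T_\ell\to\mathcal T_{[1,\ell]}$ is $\Pi(T\otimes T')=(j_1<\cdots<j_{\alpha_T}<i_{\alpha_T+1}<\cdots<i_\ell)$. *)

theory Defs
  imports
    Complex_Main
    "HOL-Library.FuncSet"
    "HOL-Library.Poly_Mapping"
    "HOL-Computational_Algebra.Computational_Algebra"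
    "HOL-Computational_Algebra.Field_as_Ring"
    "HOL-Algebra.QuotRing"
begin

section \<open>The algebra\<close>

subsection \<open>Free algebras\<close>

text \<open>Words form a monoid under concatenation (written additively), so that
  \<open>'g fword \<Rightarrow>\<^sub>0 complex\<close>, with the convolution product, is the free
  unital associative algebra on the type of generators.\<close>

datatype 'g fword = FWord "'g list"

instantiation fword :: (type) monoid_add
begin

definition zero_fword :: "'a fword" where "zero_fword = FWord []"

fun plus_fword :: "'a fword \<Rightarrow> 'a fword \<Rightarrow> 'a fword" where
  "plus_fword (FWord xs) (FWord ys) = FWord (xs @ ys)"

instance
proof
  fix a b c :: "'a fword"
  show "a + b + c = a + (b + c)" by (cases a; cases b; cases c) simp
  show "0 + a = a" by (cases a) (simp add: zero_fword_def)
  show "a + 0 = a" by (cases a) (simp add: zero_fword_def)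
qed

end

type_synonym 'g falg = "'g fword \<Rightarrow>\<^sub>0 complex"

definition scalar :: "complex \<Rightarrow> 'g falg" where
  "scalar c = Poly_Mapping.single 0 c"

definition gen :: "'g \<Rightarrow> 'g falg" where
  "gen g = Poly_Mapping.single (FWord [g]) 1"

definition free_algebra :: "'g falg ring" where
  "free_algebra = \<lparr>carrier = UNIV, mult = (*), one = 1, zero = 0, add = (+)\<rparr>"

lemma ring_free_algebra: "ring (free_algebra :: 'g falg ring)"
proof (rule ringI)
  show "abelian_group (free_algebra :: 'g falg ring)"
  proof (rule abelian_groupI)
    fix x :: "'g falg"
    show "\<exists>y\<in>carrier free_algebra. y \<oplus>\<^bsub>free_algebra\<^esub> x = \<zero>\<^bsub>free_algebra\<^esub>"
      by (rule bexI[of _ "- x"]) (simp_all add: free_algebra_def)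
  qed (simp_all add: free_algebra_def algebra_simps)
  show "monoid (free_algebra :: 'g falg ring)"
    by (rule monoidI) (simp_all add: free_algebra_def algebra_simps)
qed (simp_all add: free_algebra_def algebra_simps)

subsection \<open>Generators\<close>

datatype pm = Pos | Neg

fun sg :: "pm \<Rightarrow> int" where
  "sg Pos = 1"
| "sg Neg = - 1"

text \<open>The space with basis \<open>h\<^sub>i\<close>, and the functionals
  \<open>\<Lambda>\<^sub>i\<close>, \<open>\<alpha>\<^sub>i\<close> on it.\<close>

type_synonym cartan_h = "int \<Rightarrow>\<^sub>0 rat"

definition h_basis :: "int \<Rightarrow> cartan_h" where
  "h_basis i = Poly_Mapping.single i 1"

definition Lam :: "int \<Rightarrow> cartan_h \<Rightarrow> rat" where
  "Lam i h = Poly_Mapping.lookup h i"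

definition alpha :: "int \<Rightarrow> cartan_h \<Rightarrow> rat" where
  "alpha i h = 2 * Lam i h - Lam (i - 1) h - Lam (i + 1) h"

definition Cartan :: "int \<Rightarrow> int \<Rightarrow> int" where
  "Cartan i j = (if i = j then 2 else if \<bar>i - j\<bar> = 1 then - 1 else 0)"

definition qpow :: "complex \<Rightarrow> rat \<Rightarrow> complex" where
  "qpow t r = exp (t * of_rat r)"

text \<open>\<open>H i m\<close> stands for \<open>h\<^sub>i\<^sub>,\<^sub>m\<close>. The
  symbols \<open>H i 0\<close>, which are not among the generators, are set to \<open>0\<close> by the
  first relation below.\<close>

datatype generator = X pm int int | K cartan_h | H int int

subsection \<open>The currents \<open>\<phi>\<close>\<close>

text \<open>The exponential of a formal power series without constant term, over a possibly
  noncommutative algebra.\<close>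

definition exp_series :: "'g falg fps \<Rightarrow> 'g falg fps" where
  "exp_series F = Abs_fps (\<lambda>n. \<Sum>k\<le>n. scalar (1 / fact k) * fps_nth (F ^ k) n)"

definition h_series :: "complex \<Rightarrow> pm \<Rightarrow> int \<Rightarrow> generator falg fps" where
  "h_series t \<epsilon> i = Abs_fps (\<lambda>m. if m = 0 then 0 else
     scalar (of_int (sg \<epsilon>) * (exp t - inverse (exp t))) * gen (H i (sg \<epsilon> * int m)))"

text \<open>The coefficient of \<open>z\<^sup>r\<close> in \<open>\<phi>\<^sub>i\<^sup>\<epsilon>(z)\<close>, for all integers \<open>r\<close>.\<close>

definition phi_free :: "complex \<Rightarrow> pm \<Rightarrow> int \<Rightarrow> int \<Rightarrow> generator falg" where
  "phi_free t \<epsilon> i r = (if sg \<epsilon> * r < 0 then 0 else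
     gen (K (case \<epsilon> of Pos \<Rightarrow> h_basis i | Neg \<Rightarrow> - h_basis i)) *
     fps_nth (exp_series (h_series t \<epsilon> i)) (nat (sg \<epsilon> * r)))"

subsection \<open>Relations\<close>

definition serre_half ::
  "complex \<Rightarrow> pm \<Rightarrow> int \<Rightarrow> int \<Rightarrow> int \<Rightarrow> int \<Rightarrow> int \<Rightarrow> generator falg" where
  "serre_half t \<eta> i j r u s =
     gen (X \<eta> i r) * gen (X \<eta> i u) * gen (X \<eta> j s)
     - scalar (exp t + inverse (exp t)) * gen (X \<eta> i r) * gen (X \<eta> j s) * gen (X \<eta> i u)
     + gen (X \<eta> j s) * gen (X \<eta> i r) * gen (X \<eta> i u)"

text \<open>Each element is the difference of the two sides of a defining relation. Relations between
  currents are given by their coefficients: that of \<open>z\<^sup>r w\<^sup>s\<close> in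
  \<open>phi_x\<close>, \<open>x_plus_minus\<close>, \<open>x_x\<close> and \<open>x_far\<close>,
  and that of \<open>z\<^sub>1\<^sup>r z\<^sub>2\<^sup>u w\<^sup>s\<close> in \<open>serre\<close>.
  The coefficient of \<open>z\<^sup>r w\<^sup>s\<close> is \<open>\<phi>\<^sup>+\<^sub>i\<^sub>,\<^sub>r\<^sub>+\<^sub>s\<close> in
  \<open>\<delta>(w/z) \<phi>\<^sub>i\<^sup>+(w)\<close>, and \<open>\<phi>\<^sup>-\<^sub>i\<^sub>,\<^sub>r\<^sub>+\<^sub>s\<close> in
  \<open>\<delta>(z/w) \<phi>\<^sub>i\<^sup>-(z)\<close>.\<close>

inductive_set Uq_relations :: "complex \<Rightarrow> generator falg set" for t :: complex where
  h_zero: "gen (H i 0) \<in> Uq_relations t"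
| k_mult: "gen (K h) * gen (K h') - gen (K (h + h')) \<in> Uq_relations t"
| k_zero: "gen (K 0) - 1 \<in> Uq_relations t"
| k_k: "gen (K h) * gen (K h') - gen (K h') * gen (K h) \<in> Uq_relations t"
| k_phi: "gen (K h) * phi_free t \<epsilon> i r - phi_free t \<epsilon> i r * gen (K h) \<in> Uq_relations t"
| phi_phi: "phi_free t \<epsilon> i r * phi_free t \<epsilon>' j s - phi_free t \<epsilon>' j s * phi_free t \<epsilon> i r
     \<in> Uq_relations t"
| k_x: "gen (K h) * gen (X \<eta> j r) * gen (K (- h))
     - scalar (qpow t (of_int (sg \<eta>) * alpha j h)) * gen (X \<eta> j r) \<in> Uq_relations t"
| phi_x: "c = scalar (exp t powi (sg \<eta> * Cartan i j)) \<Longrightarrow>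
     (phi_free t \<epsilon> i r * gen (X \<eta> j (s - 1)) - c * phi_free t \<epsilon> i (r - 1) * gen (X \<eta> j s))
     - (c * gen (X \<eta> j (s - 1)) * phi_free t \<epsilon> i r - gen (X \<eta> j s) * phi_free t \<epsilon> i (r - 1))
     \<in> Uq_relations t"
| x_plus_minus: "(gen (X Pos i r) * gen (X Neg j s) - gen (X Neg j s) * gen (X Pos i r))
     - (if i = j then scalar (1 / (exp t - inverse (exp t))) *
          (phi_free t Pos i (r + s) - phi_free t Neg i (r + s)) else 0) \<in> Uq_relations t"
| x_x: "c = scalar (exp t powi (sg \<eta> * Cartan i j)) \<Longrightarrow>
     (gen (X \<eta> i r) * gen (X \<eta> j (s - 1)) - c * gen (X \<eta> i (r - 1)) * gen (X \<eta> j s))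
     - (c * gen (X \<eta> j (s - 1)) * gen (X \<eta> i r) - gen (X \<eta> j s) * gen (X \<eta> i (r - 1)))
     \<in> Uq_relations t"
| serre: "\<bar>i - j\<bar> = 1 \<Longrightarrow>
     serre_half t \<eta> i j r u s + serre_half t \<eta> i j u r s \<in> Uq_relations t"
| x_far: "\<bar>i - j\<bar> \<ge> 2 \<Longrightarrow>
     gen (X \<eta> i r) * gen (X \<eta> j s) - gen (X \<eta> j s) * gen (X \<eta> i r) \<in> Uq_relations t"

text \<open>\<^const>\<open>genideal\<close> is the two-sided ideal generated by a set.\<close>

definition Uq_ideal :: "complex \<Rightarrow> generator falg set" where
  "Uq_ideal t = genideal free_algebra (Uq_relations t)"

definition Uq :: "complex \<Rightarrow> generator falg set ring" where
  "Uq t = FactRing free_algebra (Uq_ideal t)"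

definition Uq_class :: "complex \<Rightarrow> generator falg \<Rightarrow> generator falg set" where
  "Uq_class t u = a_r_coset free_algebra (Uq_ideal t) u"

definition x_coeff :: "complex \<Rightarrow> pm \<Rightarrow> int \<Rightarrow> int \<Rightarrow> generator falg set" where
  "x_coeff t \<eta> i r = Uq_class t (gen (X \<eta> i r))"

definition phi_coeff :: "complex \<Rightarrow> pm \<Rightarrow> int \<Rightarrow> int \<Rightarrow> generator falg set" where
  "phi_coeff t \<epsilon> i r = Uq_class t (phi_free t \<epsilon> i r)"

section \<open>Modules\<close>

text \<open>\<open>free_space B\<close> is the complex vector space with basis \<open>B\<close>.\<close>

definition free_space :: "'b set \<Rightarrow> ('b \<Rightarrow>\<^sub>0 complex) set" where
  "free_space B = {v. Poly_Mapping.keys v \<subseteq> B}"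

definition scale :: "complex \<Rightarrow> ('b \<Rightarrow>\<^sub>0 complex) \<Rightarrow> ('b \<Rightarrow>\<^sub>0 complex)" where
  "scale c v = Poly_Mapping.map ((*) c) v"

definition basis_vec :: "'b \<Rightarrow> ('b \<Rightarrow>\<^sub>0 complex)" where
  "basis_vec x = Poly_Mapping.single x 1"

definition tensor :: "('b \<Rightarrow>\<^sub>0 complex) \<Rightarrow> ('c \<Rightarrow>\<^sub>0 complex) \<Rightarrow> ('b \<times> 'c \<Rightarrow>\<^sub>0 complex)" where
  "tensor u v = (\<Sum>x\<in>Poly_Mapping.keys u. \<Sum>y\<in>Poly_Mapping.keys v.
     Poly_Mapping.single (x, y) (Poly_Mapping.lookup u x * Poly_Mapping.lookup v y))"

text \<open>Left modules over \<open>Uq t\<close>, with underlying vector space \<open>free_space B\<close>. Linearity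
  of the action of each element follows, since the scalars are central.\<close>

type_synonym 'b action = "generator falg set \<Rightarrow> ('b \<Rightarrow>\<^sub>0 complex) \<Rightarrow> ('b \<Rightarrow>\<^sub>0 complex)"

locale Uq_module =
  fixes t :: complex and B :: "'b set" and act :: "'b action"
  assumes act_closed: "u \<in> carrier (Uq t) \<Longrightarrow> v \<in> free_space B \<Longrightarrow> act u v \<in> free_space B"
    and act_add_right: "u \<in> carrier (Uq t) \<Longrightarrow> v \<in> free_space B \<Longrightarrow> w \<in> free_space B \<Longrightarrow>
      act u (v + w) = act u v + act u w"
    and act_add_left: "u \<in> carrier (Uq t) \<Longrightarrow> u' \<in> carrier (Uq t) \<Longrightarrow> v \<in> free_space B \<Longrightarrow>
      act (u \<oplus>\<^bsub>Uq t\<^esub> u') v = act u v + act u' v"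
    and act_mult: "u \<in> carrier (Uq t) \<Longrightarrow> u' \<in> carrier (Uq t) \<Longrightarrow> v \<in> free_space B \<Longrightarrow>
      act (u \<otimes>\<^bsub>Uq t\<^esub> u') v = act u (act u' v)"
    and act_scalar: "v \<in> free_space B \<Longrightarrow> act (Uq_class t (scalar c)) v = scale c v"

section \<open>Rational functions and formal distributions\<close>

type_synonym ratfun = "complex poly fract"

text \<open>\<^const>\<open>quot_of_fract\<close> gives numerator and denominator in lowest terms.\<close>

definition rat_pole :: "ratfun \<Rightarrow> complex \<Rightarrow> bool" where
  "rat_pole f x \<longleftrightarrow> poly (snd (quot_of_fract f)) x = 0"

definition rat_eval :: "ratfun \<Rightarrow> complex \<Rightarrow> complex" where
  "rat_eval f x = poly (fst (quot_of_fract f)) x / poly (snd (quot_of_fract f)) x"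

definition rat_eval_fls :: "ratfun \<Rightarrow> complex fls \<Rightarrow> complex fls" where
  "rat_eval_fls f x = poly (map_poly fls_const (fst (quot_of_fract f))) x /
     poly (map_poly fls_const (snd (quot_of_fract f))) x"

text \<open>The coefficient of \<open>z\<^sup>r\<close> in the expansion of \<open>f(z)\<close> as a Laurent series in
  \<open>z\<close> (for \<open>Pos\<close>), or in \<open>z\<^sup>-\<^sup>1\<close> (for \<open>Neg\<close>). In the latter case the
  indeterminate of the Laurent series is \<open>z\<^sup>-\<^sup>1\<close>.\<close>

definition expand :: "pm \<Rightarrow> ratfun \<Rightarrow> int \<Rightarrow> complex" where
  "expand \<epsilon> f r = (case \<epsilon> of
     Pos \<Rightarrow> fls_nth (rat_eval_fls f fls_X) r
   | Neg \<Rightarrow> fls_nth (rat_eval_fls f fls_X_inv) (- r))"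

text \<open>\<open>\<psi>(cz)\<close> as a rational function of \<open>z\<close>, where
  \<open>\<psi>(z) = (q - q\<^sup>-\<^sup>1 z) / (1 - z)\<close>.\<close>

definition psi :: "complex \<Rightarrow> complex \<Rightarrow> ratfun" where
  "psi t c = Fract [:exp t, - (inverse (exp t) * c):] [:1, - c:]"

text \<open>The coefficient of \<open>z\<^sup>r\<close> in \<open>\<delta>(cz)\<close>.\<close>

definition delta :: "complex \<Rightarrow> int \<Rightarrow> complex" where
  "delta c r = c powi r"

text \<open>\<open>\<phi>\<^sub>i\<^sup>\<epsilon>(z) v = f(z) v\<close>\<close>

definition phi_acts_by :: "complex \<Rightarrow> 'b action \<Rightarrow> pm \<Rightarrow> int \<Rightarrow> ('b \<Rightarrow>\<^sub>0 complex) \<Rightarrow> ratfun \<Rightarrow> bool" where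
  "phi_acts_by t act \<epsilon> i v f \<longleftrightarrow> (\<forall>r. act (phi_coeff t \<epsilon> i r) v = scale (expand \<epsilon> f r) v)"

text \<open>The formal distribution \<open>D\<close> is \<open>\<Sum>\<^sub>c\<^sub>\<in>\<^sub>C \<delta>(cz) y\<^sub>c\<close>.\<close>

definition is_delta_sum ::
  "(int \<Rightarrow> ('b \<Rightarrow>\<^sub>0 complex)) \<Rightarrow> complex set \<Rightarrow> (complex \<Rightarrow> ('b \<Rightarrow>\<^sub>0 complex)) \<Rightarrow> bool" where
  "is_delta_sum D C y \<longleftrightarrow> finite C \<and> 0 \<notin> C \<and> (\<forall>r. D r = (\<Sum>c\<in>C. scale (delta c r) (y c)))"

section \<open>Tensor products along the Drinfeld coproduct\<close>

text \<open>\<open>act\<close> is a module structure on the tensor product of the modules given by \<open>act1\<close> and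
  \<open>act2\<close>, in which the currents act through the Drinfeld coproduct. In the second and third
  clauses, \<open>f(z) \<delta>(cz)\<close> is read as \<open>f(c\<^sup>-\<^sup>1) \<delta>(cz)\<close>, provided that
  \<open>f\<close> has no pole at \<open>c\<^sup>-\<^sup>1\<close>. The sum in the first clause is the Cauchy
  product; the clause is trivial when \<open>n\<close> has the wrong sign.\<close>

definition drinfeld_tensor ::
  "complex \<Rightarrow> 'b set \<Rightarrow> 'b action \<Rightarrow> 'c set \<Rightarrow> 'c action \<Rightarrow> ('b \<times> 'c) action \<Rightarrow> bool" where
  "drinfeld_tensor t B1 act1 B2 act2 act \<longleftrightarrow>
     Uq_module t (B1 \<times> B2) act \<and>
     (\<forall>u \<in> free_space B1. \<forall>v \<in> free_space B2. \<forall>i.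
       (\<forall>\<epsilon> n. act (phi_coeff t \<epsilon> i n) (tensor u v) =
          (\<Sum>m = min 0 n..max 0 n.
             tensor (act1 (phi_coeff t \<epsilon> i m) u) (act2 (phi_coeff t \<epsilon> i (n - m)) v))) \<and>
       (\<forall>f C y. phi_acts_by t act1 Neg i u f \<and>
          is_delta_sum (\<lambda>r. act2 (x_coeff t Pos i r) v) C y \<and>
          (\<forall>c\<in>C. y c \<in> free_space B2 \<and> \<not> rat_pole f (inverse c)) \<longrightarrow>
          (\<forall>r. act (x_coeff t Pos i r) (tensor u v) =
             tensor (act1 (x_coeff t Pos i r) u) v +
             (\<Sum>c\<in>C. scale (rat_eval f (inverse c) * delta c r) (tensor u (y c))))) \<and>
       (\<forall>f C y. phi_acts_by t act2 Pos i v f \<and>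
          is_delta_sum (\<lambda>r. act1 (x_coeff t Neg i r) u) C y \<and>
          (\<forall>c\<in>C. y c \<in> free_space B1 \<and> \<not> rat_pole f (inverse c)) \<longrightarrow>
          (\<forall>r. act (x_coeff t Neg i r) (tensor u v) =
             (\<Sum>c\<in>C. scale (rat_eval f (inverse c) * delta c r) (tensor (y c) v)) +
             tensor u (act2 (x_coeff t Neg i r) v))))"

section \<open>Sequences\<close>

text \<open>A sequence indexed by \<open>I\<close> is a function that is \<^const>\<open>undefined\<close> outside \<open>I\<close>.\<close>

type_synonym seq = "int \<Rightarrow> int"

definition incr_seqs :: "int set \<Rightarrow> seq set" where
  "incr_seqs I = {T \<in> extensional I. strict_mono_on I T}"

definition T_plus :: "int \<Rightarrow> seq set" where
  "T_plus l = {T \<in> incr_seqs {..l}. \<forall>\<^sub>F p in at_bot. T p = p}"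

definition T_minus :: "seq set" where
  "T_minus = {T \<in> incr_seqs {1..}. \<forall>\<^sub>F p in at_top. T p = p}"

definition T_seg :: "int \<Rightarrow> seq set" where
  "T_seg l = incr_seqs {1..l}"

text \<open>The value \<open>0\<close> of the operators is represented by \<^const>\<open>None\<close>.\<close>

definition e_op :: "int set \<Rightarrow> int \<Rightarrow> seq \<Rightarrow> seq option" where
  "e_op I i T = (if i + 1 \<in> T ` I \<and> i \<notin> T ` I
     then Some (\<lambda>p\<in>I. if T p = i + 1 then i else T p) else None)"

definition f_op :: "int set \<Rightarrow> int \<Rightarrow> seq \<Rightarrow> seq option" where
  "f_op I i T = (if i \<in> T ` I \<and> i + 1 \<notin> T ` I
     then Some (\<lambda>p\<in>I. if T p = i then i + 1 else T p) else None)"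

section \<open>Fundamental modules\<close>

definition seq_vec :: "seq option \<Rightarrow> (seq \<Rightarrow>\<^sub>0 complex)" where
  "seq_vec T = (case T of None \<Rightarrow> 0 | Some S \<Rightarrow> basis_vec S)"

text \<open>The sums range over the indices with nonzero Kronecker symbol, of which there is at most one,
  because a sum over an infinite index set \<open>I\<close> would be \<open>0\<close> by convention.\<close>

definition fundamental_module ::
  "complex \<Rightarrow> int set \<Rightarrow> seq set \<Rightarrow> int \<Rightarrow> complex \<Rightarrow> seq action \<Rightarrow> bool" where
  "fundamental_module t I B N b act \<longleftrightarrow>
     Uq_module t B act \<and>
     (\<forall>T\<in>B. \<forall>i.
       (\<forall>r. act (x_coeff t Pos i r) (basis_vec T) =
          (\<Sum>p | p \<in> I \<and> T p = i + 1.
             scale (delta (b * exp t powi (i + N + 1 - 2 * p)) r) (seq_vec (e_op I i T)))) \<and>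
       (\<forall>r. act (x_coeff t Neg i r) (basis_vec T) =
          (\<Sum>p | p \<in> I \<and> T p = i.
             scale (delta (b * exp t powi (i + N + 1 - 2 * p)) r) (seq_vec (f_op I i T)))) \<and>
       (\<forall>\<epsilon>.
         (\<forall>p\<in>I. T p = i + 1 \<and> i \<notin> T ` I \<longrightarrow>
            phi_acts_by t act \<epsilon> i (basis_vec T)
              (inverse (psi t (b * exp t powi (i + N + 3 - 2 * p))))) \<and>
         (\<forall>p\<in>I. T p = i \<and> i + 1 \<notin> T ` I \<longrightarrow>
            phi_acts_by t act \<epsilon> i (basis_vec T)
              (psi t (b * exp t powi (i + N + 1 - 2 * p)))) \<and>
         ((i \<in> T ` I \<longleftrightarrow> i + 1 \<in> T ` I) \<longrightarrow>
            phi_acts_by t act \<epsilon> i (basis_vec T) 1)))"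

text \<open>\<open>act\<close> is the action on \<open>V(Y\<^sub>l\<^sub>,\<^sub>b)\<close>, with underlying space
  \<open>free_space (T_plus l)\<close>, respectively on \<open>V(Y\<^sub>0\<^sub>,\<^sub>b\<^sup>-\<^sup>1)\<close>,
  with underlying space \<open>free_space T_minus\<close>.\<close>

definition fundamental_highest :: "complex \<Rightarrow> int \<Rightarrow> complex \<Rightarrow> seq action \<Rightarrow> bool" where
  "fundamental_highest t l b act \<longleftrightarrow> fundamental_module t {..l} (T_plus l) l b act"

definition fundamental_lowest :: "complex \<Rightarrow> complex \<Rightarrow> seq action \<Rightarrow> bool" where
  "fundamental_lowest t b act \<longleftrightarrow> fundamental_module t {1..} T_minus 0 b act"

section \<open>The extremal fundamental loop weight module\<close>

definition alpha_idx :: "int \<Rightarrow> seq \<Rightarrow> int" where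
  "alpha_idx l T = Sup {p. p \<le> l \<and> T p = p}"

definition beta_idx :: "seq \<Rightarrow> int" where
  "beta_idx T' = Inf {p. 1 \<le> p \<and> T' p = p}"

definition T_pairs :: "int \<Rightarrow> (seq \<times> seq) set" where
  "T_pairs l = {(T, T'). T \<in> T_plus l \<and> T' \<in> T_minus \<and> alpha_idx l T \<ge> beta_idx T' - 1}"

definition Pi_map :: "int \<Rightarrow> seq \<times> seq \<Rightarrow> seq" where
  "Pi_map l = (\<lambda>(T, T'). \<lambda>p\<in>{1..l}. if p \<le> alpha_idx l T then T' p else T p)"

subsection \<open>The bijection \<open>\<Pi>\<close>\<close>

lemma slack_mono:
  fixes T :: seq
  assumes "strict_mono_on I T" "{p..p'} \<subseteq> I" "p \<le> p'"
  shows "T p - p \<le> T p' - p'"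
  using assms(3,2)
proof (induction p' rule: int_ge_induct)
  case base
  then show ?case by simp
next
  case (step k)
  have "T k < T (k + 1)"
    using step.prems step.hyps by (intro strict_mono_onD[OF assms(1)]) auto
  moreover have "T p - p \<le> T k - k"
    using step.prems by (intro step.IH) auto
  ultimately show ?case by linarith
qed

lemma T_plus_ge:
  assumes "T \<in> T_plus l" "p \<le> l"
  shows "T p \<ge> p"
proof -
  obtain P where P: "\<And>p. p \<le> P \<Longrightarrow> T p = p"
    using assms(1) by (auto simp: T_plus_def eventually_at_bot_linorder)
  have "T (min P p) - min P p \<le> T p - p"
    by (rule slack_mono[of "{..l}"]) (use assms in \<open>auto simp: T_plus_def incr_seqs_def\<close>)
  then show ?thesis using P[of "min P p"] by simp
qed

lemma T_minus_le:
  assumes "T \<in> T_minus" "p \<ge> 1"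
  shows "T p \<le> p"
proof -
  obtain P where P: "\<And>p. p \<ge> P \<Longrightarrow> T p = p"
    using assms(1) by (auto simp: T_minus_def eventually_at_top_linorder)
  have "T p - p \<le> T (max P p) - max P p"
    by (rule slack_mono[of "{1..}"]) (use assms in \<open>auto simp: T_minus_def incr_seqs_def\<close>)
  then show ?thesis using P[of "max P p"] by simp
qed

lemma alpha_idx:
  assumes T: "T \<in> T_plus l"
  shows "alpha_idx l T \<le> l" and "p \<le> l \<Longrightarrow> T p = p \<longleftrightarrow> p \<le> alpha_idx l T"
proof -
  let ?A = "{p. p \<le> l \<and> T p = p}"
  obtain P where P: "\<And>p. p \<le> P \<Longrightarrow> T p = p"
    using T by (auto simp: T_plus_def eventually_at_bot_linorder)
  have ne: "?A \<noteq> {}" using P[of "min P l"] by (auto intro!: exI[of _ "min P l"])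
  have bdd: "bdd_above ?A" by auto
  obtain x where x: "x \<in> ?A" "Sup ?A - 1 < x"
    using less_cSup_iff[OF ne bdd, of "Sup ?A - 1"] by auto
  have "x \<le> Sup ?A" using x bdd by (intro cSup_upper) auto
  with x have "Sup ?A = x" by linarith
  with x have mem: "alpha_idx l T \<in> ?A" by (simp add: alpha_idx_def)
  then show "alpha_idx l T \<le> l" by simp
  show "T p = p \<longleftrightarrow> p \<le> alpha_idx l T" if "p \<le> l"
  proof
    show "p \<le> alpha_idx l T" if "T p = p"
      unfolding alpha_idx_def using that \<open>p \<le> l\<close> bdd by (intro cSup_upper) auto
    assume "p \<le> alpha_idx l T"
    then have "T p - p \<le> T (alpha_idx l T) - alpha_idx l T"
      using T mem by (intro slack_mono[of "{..l}"]) (auto simp: T_plus_def incr_seqs_def)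
    then show "T p = p" using mem T_plus_ge[OF T \<open>p \<le> l\<close>] by simp
  qed
qed

lemma beta_idx:
  assumes T: "T \<in> T_minus"
  shows "beta_idx T \<ge> 1" and "p \<ge> 1 \<Longrightarrow> T p = p \<longleftrightarrow> p \<ge> beta_idx T"
proof -
  let ?A = "{p. 1 \<le> p \<and> T p = p}"
  obtain P where P: "\<And>p. p \<ge> P \<Longrightarrow> T p = p"
    using T by (auto simp: T_minus_def eventually_at_top_linorder)
  have ne: "?A \<noteq> {}" using P[of "max P 1"] by (auto intro!: exI[of _ "max P 1"])
  have bdd: "bdd_below ?A" by auto
  obtain x where x: "x \<in> ?A" "x < Inf ?A + 1"
    using cInf_less_iff[OF ne bdd, of "Inf ?A + 1"] by auto
  have "x \<ge> Inf ?A" using x bdd by (intro cInf_lower) auto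
  with x have "Inf ?A = x" by linarith
  with x have mem: "beta_idx T \<in> ?A" by (simp add: beta_idx_def)
  then show "beta_idx T \<ge> 1" by simp
  show "T p = p \<longleftrightarrow> p \<ge> beta_idx T" if "p \<ge> 1"
  proof
    show "p \<ge> beta_idx T" if "T p = p"
      unfolding beta_idx_def using that \<open>p \<ge> 1\<close> bdd by (intro cInf_lower) auto
    assume "p \<ge> beta_idx T"
    then have "T (beta_idx T) - beta_idx T \<le> T p - p"
      using T mem by (intro slack_mono[of "{1..}"]) (auto simp: T_minus_def incr_seqs_def)
    then show "T p = p" using mem T_minus_le[OF T \<open>p \<ge> 1\<close>] by simp
  qed
qed

lemma bij_Pi_map:
  assumes "l \<ge> 1"
  shows "bij_betw (Pi_map l) (T_pairs l) (T_seg l)"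
proof -
  define G1 :: "seq \<Rightarrow> seq" where
    "G1 R = (\<lambda>p\<in>{..l}. if p \<le> 0 \<or> R p \<le> p then p else R p)" for R
  define G2 :: "seq \<Rightarrow> seq" where
    "G2 R = (\<lambda>p\<in>{1..}. if p \<le> l \<and> R p \<le> p then R p else p)" for R
  have left: "(G1 (Pi_map l (S, S')), G2 (Pi_map l (S, S'))) = (S, S')"
    and into: "Pi_map l (S, S') \<in> T_seg l" if "(S, S') \<in> T_pairs l" for S S'
  proof -
    let ?\<alpha> = "alpha_idx l S"
    from that have S: "S \<in> T_plus l" and S': "S' \<in> T_minus" and ab: "?\<alpha> \<ge> beta_idx S' - 1"
      by (auto simp: T_pairs_def)
    note a = alpha_idx[OF S] and b = beta_idx[OF S']
    note ge = T_plus_ge[OF S] and le = T_minus_le[OF S']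
    have a0: "?\<alpha> \<ge> 0" using ab b(1) by simp
    have R: "Pi_map l (S, S') p \<le> p \<longleftrightarrow> p \<le> ?\<alpha>" if "1 \<le> p" "p \<le> l" for p
      using that a(2)[of p] ge[of p] le[of p] by (auto simp: Pi_map_def)
    have "G1 (Pi_map l (S, S')) p = S p" for p
    proof (cases "p \<le> l")
      case True
      then show ?thesis
        using a(2)[of p] a0 R[of p] by (auto simp: G1_def Pi_map_def)
    next
      case False
      then show ?thesis using S by (auto simp: G1_def T_plus_def incr_seqs_def extensional_def)
    qed
    moreover have "G2 (Pi_map l (S, S')) p = S' p" for p
    proof (cases "p \<ge> 1")
      case True
      then show ?thesis
        using a(1) b(2)[of p] ab R[of p] by (auto simp: G2_def Pi_map_def)
    next
      case False
      then show ?thesis using S' by (auto simp: G2_def T_minus_def incr_seqs_def extensional_def)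
    qed
    ultimately show "(G1 (Pi_map l (S, S')), G2 (Pi_map l (S, S'))) = (S, S')" by auto
    have "strict_mono_on {1..l} (Pi_map l (S, S'))"
    proof (rule strict_mono_onI)
      fix p r assume pr: "p \<in> {1..l}" "r \<in> {1..l}" "p < r"
      have "S p < S r"
        using S pr by (auto simp: T_plus_def incr_seqs_def intro: strict_mono_onD)
      moreover have "S' p < S' r"
        using S' pr by (auto simp: T_minus_def incr_seqs_def intro: strict_mono_onD)
      ultimately show "Pi_map l (S, S') p < Pi_map l (S, S') r"
        using pr ge[of r] le[of p] by (auto simp: Pi_map_def)
    qed
    then show "Pi_map l (S, S') \<in> T_seg l"
      by (auto simp: T_seg_def incr_seqs_def Pi_map_def)
  qed
  have right: "Pi_map l (G1 R, G2 R) = R" and pairs: "(G1 R, G2 R) \<in> T_pairs l"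
    if "R \<in> T_seg l" for R
  proof -
    from that have mono: "strict_mono_on {1..l} R" and ext: "R \<in> extensional {1..l}"
      by (auto simp: T_seg_def incr_seqs_def)
    have slack: "R p - p \<le> R r - r" if "1 \<le> p" "p \<le> r" "r \<le> l" for p r
      using that by (intro slack_mono[OF mono]) auto
    have "strict_mono_on {..l} (G1 R)"
    proof (rule strict_mono_onI)
      fix p r assume "p \<in> {..l}" "r \<in> {..l}" "p < r"
      then show "G1 R p < G1 R r" using slack[of p r] by (auto simp: G1_def)
    qed
    moreover have "\<forall>\<^sub>F p in at_bot. G1 R p = p"
      using eventually_le_at_bot[of "0::int"]
      by eventually_elim (use assms in \<open>auto simp: G1_def\<close>)
    ultimately have G1: "G1 R \<in> T_plus l"
      by (auto simp: T_plus_def incr_seqs_def G1_def)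
    have "strict_mono_on {1..} (G2 R)"
    proof (rule strict_mono_onI)
      fix p r :: int assume "p \<in> {1..}" "r \<in> {1..}" "p < r"
      then show "G2 R p < G2 R r" using slack[of p r] by (auto simp: G2_def)
    qed
    moreover have "\<forall>\<^sub>F p in at_top. G2 R p = p"
      using eventually_gt_at_top[of l]
      by eventually_elim (use assms in \<open>auto simp: G2_def\<close>)
    ultimately have G2: "G2 R \<in> T_minus"
      by (auto simp: T_minus_def incr_seqs_def G2_def)
    let ?\<alpha> = "alpha_idx l (G1 R)"
    note a = alpha_idx[OF G1]
    have al: "p \<le> ?\<alpha> \<longleftrightarrow> R p \<le> p" if "1 \<le> p" "p \<le> l" for p
    proof -
      have "p \<le> ?\<alpha> \<longleftrightarrow> G1 R p = p" using a(2)[of p] that by simp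
      also have "\<dots> \<longleftrightarrow> R p \<le> p" using that by (auto simp: G1_def)
      finally show ?thesis .
    qed
    have a0: "?\<alpha> \<ge> 0" using a(2)[of 0] assms by (auto simp: G1_def)
    show "Pi_map l (G1 R, G2 R) = R"
    proof
      fix p
      show "Pi_map l (G1 R, G2 R) p = R p"
        using al[of p] ext by (auto simp: Pi_map_def G1_def G2_def extensional_def)
    qed
    have "G2 R (?\<alpha> + 1) = ?\<alpha> + 1"
      using al[of "?\<alpha> + 1"] a0 by (auto simp: G2_def)
    then have "beta_idx (G2 R) \<le> ?\<alpha> + 1"
      using beta_idx(2)[OF G2, of "?\<alpha> + 1"] a0 by simp
    then show "(G1 R, G2 R) \<in> T_pairs l" using G1 G2 by (simp add: T_pairs_def)
  qed
  show ?thesis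
    by (rule bij_betw_byWitness[where f' = "\<lambda>R. (G1 R, G2 R)"])
      (use left into right pairs in \<open>auto simp del: Pair_inject\<close>)
qed

subsection \<open>The module\<close>

text \<open>The span of the vectors indexed by \<^const>\<open>T_pairs\<close>, with the restricted action.\<close>

definition extremal_space :: "int \<Rightarrow> (seq \<times> seq \<Rightarrow>\<^sub>0 complex) set" where
  "extremal_space l = free_space (T_pairs l)"

definition extremal_action :: "int \<Rightarrow> (seq \<times> seq) action \<Rightarrow> (seq \<times> seq) action" where
  "extremal_action l act = (\<lambda>u. restrict (act u) (extremal_space l))"

text \<open>The vector \<open>T\<^sub>a\<close> attached to a sequence in \<open>T_seg l\<close>, with
  \<open>0\<^sub>a = 0\<close>.\<close>

definition extremal_vec :: "int \<Rightarrow> seq option \<Rightarrow> (seq \<times> seq \<Rightarrow>\<^sub>0 complex)" where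
  "extremal_vec l T = (case T of None \<Rightarrow> 0
     | Some R \<Rightarrow> (case inv_into (T_pairs l) (Pi_map l) R of
         (S, S') \<Rightarrow> tensor (basis_vec S) (basis_vec S')))"

end

theory Submission
  imports Defs
begin

unbundle fps_syntax

text \<open>Let \<open>S \<otimes> S'\<close> be a basis vector, \<open>\<alpha>\<close> the index \<open>\<alpha>\<^sub>S\<close> and
  \<open>R = \<Pi>(S \<otimes> S')\<close>. All integers \<open>\<le> \<alpha>\<close> occur in \<open>S\<close>, all integers
  \<open>> \<alpha>\<close> occur in \<open>S'\<close>, and \<open>\<alpha> + 1\<close> does not occur in \<open>S\<close>. Hence the currents of
  index \<open>i\<close> act trivially on \<open>S'\<close> for \<open>i > \<alpha>\<close> and on \<open>S\<close> for \<open>i < \<alpha>\<close>, and the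
  action is that on the other factor, whose entries \<open>i\<close> and \<open>i + 1\<close> sit at the same places as in
  \<open>R\<close>. If \<open>i = \<alpha>\<close> occurs in \<open>S'\<close>, then the action on \<open>S'\<close> is trivial as for
  \<open>i > \<alpha>\<close>. If \<open>i = \<alpha>\<close> does not occur in \<open>S'\<close>, then the eigenvalues of \<open>\<phi>\<^sub>i\<close> on \<open>S\<close> and \<open>S'\<close> are
  \<open>\<psi>(cz)\<close> and \<open>\<psi>(cz)\<^sup>-\<^sup>1\<close> and cancel, while the terms of the coproduct that could leave the
  span of the admissible pairs vanish because \<open>\<psi>(q\<^sup>2) = 0\<close> and
  \<open>\<psi>(1)\<^sup>-\<^sup>1 = 0\<close>.\<close>

section \<open>Vectors and tensors\<close>

lemma lookup_scale [simp]: "Poly_Mapping.lookup (scale c v) x = c * Poly_Mapping.lookup v x"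
  by (simp add: scale_def map.rep_eq when_def)

lemma scale_0 [simp]: "scale c 0 = 0" "scale 0 v = 0"
  by (rule poly_mapping_eqI, simp)+

lemma scale_scale [simp]: "scale c (scale d v) = scale (c * d) v"
  by (rule poly_mapping_eqI) simp

lemma scale_sum_left: "scale (sum f A) v = (\<Sum>x\<in>A. scale (f x) v)"
  by (rule poly_mapping_eqI) (simp add: lookup_sum sum_distrib_right)

lemma lookup_tensor:
  "Poly_Mapping.lookup (tensor u v) (x, y) = Poly_Mapping.lookup u x * Poly_Mapping.lookup v y"
proof -
  have "Poly_Mapping.lookup (tensor u v) (x, y) =
      (\<Sum>x'\<in>Poly_Mapping.keys u. \<Sum>y'\<in>Poly_Mapping.keys v.
        if x' = x then if y' = y then Poly_Mapping.lookup u x' * Poly_Mapping.lookup v y' else 0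
        else 0)"
    unfolding tensor_def lookup_sum by (intro sum.cong) (auto simp: lookup_single when_def)
  also have "\<dots> = (\<Sum>x'\<in>Poly_Mapping.keys u. if x' = x then
      \<Sum>y'\<in>Poly_Mapping.keys v. if y' = y then Poly_Mapping.lookup u x * Poly_Mapping.lookup v y' else 0
      else 0)"
    by (intro sum.cong) auto
  also have "\<dots> = Poly_Mapping.lookup u x * Poly_Mapping.lookup v y"
    by (auto simp: sum.delta' in_keys_iff)
  finally show ?thesis .
qed

lemma poly_mapping_prod_eqI:
  assumes "\<And>x y. Poly_Mapping.lookup u (x, y) = Poly_Mapping.lookup v (x, y)"
  shows "u = v"
  using assms by (intro poly_mapping_eqI) auto

lemma tensor_0 [simp]: "tensor 0 v = 0" "tensor u 0 = 0"
  by (rule poly_mapping_prod_eqI, simp add: lookup_tensor)+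

lemma tensor_scale_left: "tensor (scale c u) v = scale c (tensor u v)"
  by (rule poly_mapping_prod_eqI) (simp add: lookup_tensor)

lemma tensor_scale_right: "tensor u (scale c v) = scale c (tensor u v)"
  by (rule poly_mapping_prod_eqI) (simp add: lookup_tensor)

lemma tensor_sum_left: "tensor (sum f A) v = (\<Sum>x\<in>A. tensor (f x) v)"
  by (rule poly_mapping_prod_eqI) (simp add: lookup_tensor lookup_sum sum_distrib_right)

lemma tensor_sum_right: "tensor u (sum f A) = (\<Sum>x\<in>A. tensor u (f x))"
  by (rule poly_mapping_prod_eqI) (simp add: lookup_tensor lookup_sum sum_distrib_left)

lemma tensor_basis_vec [simp]: "tensor (basis_vec x) (basis_vec y) = basis_vec (x, y)"
  by (rule poly_mapping_prod_eqI) (auto simp: lookup_tensor basis_vec_def lookup_single when_def)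

lemma basis_vec_in_free_space [simp]: "basis_vec x \<in> free_space B \<longleftrightarrow> x \<in> B"
  by (simp add: basis_vec_def free_space_def)

lemma zero_in_free_space [simp]: "0 \<in> free_space B"
  by (simp add: free_space_def)

section \<open>Expansions of rational functions\<close>

text \<open>Bridge from the reduced pair used by \<open>rat_pole\<close>, \<open>rat_eval\<close>
  and \<open>rat_eval_fls\<close> to an arbitrary representation, so that no fraction has to be
  reduced by hand.\<close>

lemma quot_of_fract_cross:
  fixes p d :: "complex poly"
  assumes "d \<noteq> 0"
  shows "fst (quot_of_fract (Fract p d)) * d = snd (quot_of_fract (Fract p d)) * p"
proof -
  let ?f = "quot_of_fract (Fract p d)"
  have "Fract (fst ?f) (snd ?f) = Fract p d"
    by (rule Fract_quot_of_fract)
  moreover have "snd ?f \<noteq> 0"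
    by (rule snd_quot_of_fract_nonzero)
  ultimately show ?thesis
    using assms by (metis eq_fract(1) mult.commute)
qed

text \<open>Were the reduced denominator zero at x, cross-multiplication would make the reduced
  numerator vanish there too, since d(x) is nonzero; a common factor \<open>[:- x, 1:]\<close>
  contradicts coprimality.\<close>

lemma not_rat_pole_Fract:
  assumes "poly d x \<noteq> 0"
  shows "\<not> rat_pole (Fract p d) x"
proof
  let ?f = "quot_of_fract (Fract p d)"
  assume "rat_pole (Fract p d) x"
  then have *: "poly (snd ?f) x = 0" by (simp add: rat_pole_def)
  from assms have "d \<noteq> 0" by auto
  from arg_cong[OF quot_of_fract_cross[OF this, of p], of "\<lambda>g. poly g x"] *
  have "poly (fst ?f) x = 0" using assms by simp
  with * have "[:- x, 1:] dvd fst ?f" "[:- x, 1:] dvd snd ?f"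
    by (simp_all add: poly_eq_0_iff_dvd)
  with coprime_quot_of_fract[of "Fract p d"] have "is_unit [:- x, 1:]"
    by (meson coprime_def)
  then show False by (simp add: is_unit_poly_iff)
qed

lemma rat_eval_Fract:
  assumes "poly d x \<noteq> 0"
  shows "rat_eval (Fract p d) x = poly p x / poly d x"
proof -
  from assms have "d \<noteq> 0" by auto
  from arg_cong[OF quot_of_fract_cross[OF this, of p], of "\<lambda>g. poly g x"]
  show ?thesis
    using not_rat_pole_Fract[OF assms, of p] assms
    by (simp add: rat_eval_def rat_pole_def field_simps)
qed

lemma fls_const_sum: "fls_const (sum f A) = (\<Sum>x\<in>A. fls_const (f x))"
  by (induction A rule: infinite_finite_induct) (simp_all add: fls_plus_const[symmetric])

text \<open>Together with additivity this makes evaluation at a Laurent series a ring homomorphism,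
  so that polynomial identities can be evaluated there.\<close>

lemma poly_map_fls_const_mult:
  "poly (map_poly fls_const (p * q)) (x :: complex fls) =
     poly (map_poly fls_const p) x * poly (map_poly fls_const q) x"
proof -
  have "map_poly fls_const (p * q) = map_poly fls_const p * (map_poly fls_const q :: complex fls poly)"
    by (rule poly_eqI)
      (simp add: coeff_map_poly coeff_mult fls_const_mult_const[symmetric] fls_const_sum
        del: fls_const_mult_const)
  then show ?thesis by simp
qed

lemma poly_map_fls_const_add:
  "poly (map_poly fls_const (p + q)) (x :: complex fls) =
     poly (map_poly fls_const p) x + poly (map_poly fls_const q) x"
proof -
  have "map_poly fls_const (p + q) = map_poly fls_const p + (map_poly fls_const q :: complex fls poly)"
    by (rule poly_eqI) (simp add: coeff_map_poly fls_plus_const)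
  then show ?thesis by simp
qed

lemma rat_eval_fls_Fract:
  fixes x :: "complex fls"
  assumes "poly (map_poly fls_const d) x \<noteq> 0"
  shows "rat_eval_fls (Fract p d) x = poly (map_poly fls_const p) x / poly (map_poly fls_const d) x"
proof -
  let ?f = "quot_of_fract (Fract p d)"
  let ?e = "\<lambda>g. poly (map_poly fls_const g) x"
  from assms have "d \<noteq> 0" by auto
  from arg_cong[OF quot_of_fract_cross[OF this, of p], of ?e]
  have cross: "?e (fst ?f) * ?e d = ?e (snd ?f) * ?e p"
    by (simp add: poly_map_fls_const_mult)
  have "?e (snd ?f) \<noteq> 0"
  proof
    assume *: "?e (snd ?f) = 0"
    with cross assms have **: "?e (fst ?f) = 0" by simp
    \<comment> \<open>At a Laurent series there is no linear factor to split off; evaluating a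
      Bezout identity at x gives 0 = 1 instead.\<close>
    obtain b c where "b * fst ?f + c * snd ?f = 1"
      using bezout_coefficients_fst_snd[of "fst ?f" "snd ?f"] coprime_quot_of_fract[of "Fract p d"]
      by (metis coprime_imp_gcd_eq_1)
    from arg_cong[OF this, of ?e] show False
      using * ** by (simp add: poly_map_fls_const_mult poly_map_fls_const_add)
  qed
  with cross assms show ?thesis by (simp add: rat_eval_fls_def field_simps)
qed

lemma expand_1: "expand \<epsilon> 1 r = of_bool (r = 0)"
  by (cases \<epsilon>) (simp_all add: expand_def rat_eval_fls_def)

lemma rat_eval_1 [simp]: "\<not> rat_pole 1 x" "rat_eval 1 x = 1"
  by (simp_all add: rat_eval_def rat_pole_def)

lemma inverse_psi: "inverse (psi t c) = Fract [:1, - c:] [:exp t, - (inverse (exp t) * c):]"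
  by (simp add: psi_def)

text \<open>The two substitutions are the expansions at z = 0 and at z = infinity, where a linear
  polynomial with nonzero coefficients has order 0 and a simple pole.\<close>

lemma linear_fls_subdegree:
  fixes u v :: complex
  assumes "u \<noteq> 0" "v \<noteq> 0"
  shows "poly (map_poly fls_const [:u, v:]) fls_X \<noteq> 0"
    and "poly (map_poly fls_const [:u, v:]) fls_X_inv \<noteq> 0"
    and "fls_subdegree (poly (map_poly fls_const [:u, v:]) fls_X) = 0"
    and "fls_subdegree (poly (map_poly fls_const [:u, v:]) fls_X_inv) = - 1"
proof -
  let ?F = "poly (map_poly fls_const [:u, v:]) fls_X"
  let ?G = "poly (map_poly fls_const [:u, v:]) fls_X_inv"
  have F: "?F = fls_const u + fls_X * fls_const v" and G: "?G = fls_const u + fls_X_inv * fls_const v"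
    using assms by (simp_all add: map_poly_pCons)
  have F': "?F $$ n = (if n = 0 then u else 0) + (if n = 1 then v else 0)" for n
    unfolding F by (simp add: fls_X_times_conv_shift)
  have G': "?G $$ n = (if n = 0 then u else 0) + (if n = - 1 then v else 0)" for n
    unfolding G by (simp add: fls_X_inv_times_conv_shift)
  show "?F \<noteq> 0" using F'[of 0] assms by auto
  show "?G \<noteq> 0" using G'[of "-1"] assms by auto
  show "fls_subdegree ?F = 0" by (rule fls_subdegree_eqI) (use F' assms in auto)
  show "fls_subdegree ?G = - 1" by (rule fls_subdegree_eqI) (use G' assms in auto)
qed

text \<open>Numerator and denominator of \<psi>(cz) are linear with nonzero coefficients, so at both
  points they have the same order and their quotient has order 0.\<close>

lemma psi_fls:
  assumes "c \<noteq> 0" and x: "x \<in> {fls_X, fls_X_inv}"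
  shows "rat_eval_fls (psi t c) x * rat_eval_fls (inverse (psi t c)) x = 1"
    and "fls_subdegree (rat_eval_fls (psi t c) x) = 0"
    and "fls_subdegree (rat_eval_fls (inverse (psi t c)) x) = 0"
proof -
  let ?p = "poly (map_poly fls_const [:exp t, - (inverse (exp t) * c):]) x"
  let ?d = "poly (map_poly fls_const [:1, - c:]) x"
  have nz: "?p \<noteq> 0" "?d \<noteq> 0" and sub: "fls_subdegree ?p = fls_subdegree ?d"
    using x assms(1) linear_fls_subdegree[of "exp t" "- (inverse (exp t) * c)"]
      linear_fls_subdegree[of 1 "- c"] by auto
  have f: "rat_eval_fls (psi t c) x = ?p / ?d"
    unfolding psi_def by (rule rat_eval_fls_Fract) (rule nz)
  have g: "rat_eval_fls (inverse (psi t c)) x = ?d / ?p"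
    unfolding inverse_psi by (rule rat_eval_fls_Fract) (rule nz)
  show "rat_eval_fls (psi t c) x * rat_eval_fls (inverse (psi t c)) x = 1"
    using nz unfolding f g by simp
  show "fls_subdegree (rat_eval_fls (psi t c) x) = 0"
    using nz sub unfolding f by (simp add: fls_divide_subdegree)
  show "fls_subdegree (rat_eval_fls (inverse (psi t c)) x) = 0"
    using nz sub unfolding g by (simp add: fls_divide_subdegree)
qed

text \<open>For n \<ge> 0 the range is that of the Cauchy product. For n < 0 each term has m < 0 or
  n - m < 0, and both sides vanish.\<close>

lemma fls_times_nth_regular:
  fixes F G :: "complex fls"
  assumes "fls_subdegree F = 0" "fls_subdegree G = 0"
  shows "(\<Sum>m = min 0 n..max 0 n. F $$ m * G $$ (n - m)) = (F * G) $$ n"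
proof (cases "n \<ge> 0")
  case True
  then show ?thesis using assms by (simp add: fls_times_nth(2))
next
  case False
  then have "F $$ m * G $$ (n - m) = 0" if "m \<in> {n..0}" for m
    using that assms by (cases "m < 0") auto
  then have "(\<Sum>m = n..0. F $$ m * G $$ (n - m)) = 0" by (intro sum.neutral) auto
  then show ?thesis using False assms by (simp add: fls_times_nth(2))
qed

lemma expand_psi_inverse_convolution:
  assumes "c \<noteq> 0"
  shows "(\<Sum>m = min 0 n..max 0 n. expand \<epsilon> (psi t c) m * expand \<epsilon> (inverse (psi t c)) (n - m)) =
    expand \<epsilon> 1 n"
proof (cases \<epsilon>)
  case Pos
  then have "(\<Sum>m = min 0 n..max 0 n. expand \<epsilon> (psi t c) m * expand \<epsilon> (inverse (psi t c)) (n - m)) =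
      (rat_eval_fls (psi t c) fls_X * rat_eval_fls (inverse (psi t c)) fls_X) $$ n"
    using fls_times_nth_regular[OF psi_fls(2,3)[OF assms, of fls_X t], of n] by (simp add: expand_def)
  then show ?thesis using psi_fls(1)[OF assms, of fls_X t] by (simp add: expand_1)
next
  case Neg
  \<comment> \<open>For \<open>Neg\<close> the series variable is z^{-1} and \<open>expand\<close>
    reads the coefficient at -r; negating m gives the Cauchy product at -n.\<close>
  have "(\<Sum>m = min 0 n..max 0 n. expand \<epsilon> (psi t c) m * expand \<epsilon> (inverse (psi t c)) (n - m)) =
     (\<Sum>m = min 0 (- n)..max 0 (- n). rat_eval_fls (psi t c) fls_X_inv $$ m *
        rat_eval_fls (inverse (psi t c)) fls_X_inv $$ (- n - m))"
    by (rule sum.reindex_bij_witness[where i = uminus and j = uminus])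
      (auto simp: Neg expand_def min_def max_def split: if_splits)
  then show ?thesis
    using fls_times_nth_regular[OF psi_fls(2,3)[OF assms, of fls_X_inv t], of "- n"]
      psi_fls(1)[OF assms, of fls_X_inv t]
    by (simp add: expand_1)
qed

section \<open>Sequences and pairs\<close>

text \<open>Order survives because i is absent: every entry before i + 1 is already below i. The
  argument for \<open>f_op\<close> is the mirror image.\<close>

lemma e_op_incr_seqs:
  assumes "T \<in> incr_seqs I" "e_op I i T = Some U"
  shows "U \<in> incr_seqs I"
proof -
  have "strict_mono_on I U"
  proof (rule strict_mono_onI)
    fix p r assume pr: "p \<in> I" "r \<in> I" "p < r"
    with assms have "T p < T r" by (auto simp: incr_seqs_def intro: strict_mono_onD)
    moreover have "T p \<noteq> i" using assms(2) pr by (auto simp: e_op_def split: if_splits)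
    ultimately show "U p < U r" using assms(2) pr by (auto simp: e_op_def split: if_splits)
  qed
  then show ?thesis using assms(2) by (auto simp: incr_seqs_def e_op_def split: if_splits)
qed

lemma f_op_incr_seqs:
  assumes "T \<in> incr_seqs I" "f_op I i T = Some U"
  shows "U \<in> incr_seqs I"
proof -
  have "strict_mono_on I U"
  proof (rule strict_mono_onI)
    fix p r assume pr: "p \<in> I" "r \<in> I" "p < r"
    with assms have "T p < T r" by (auto simp: incr_seqs_def intro: strict_mono_onD)
    moreover have "i + 1 \<notin> T ` I" using assms(2) by (simp add: f_op_def split: if_splits)
    then have "T r \<noteq> i + 1" using pr(2) by (metis imageI)
    ultimately show "U p < U r" using assms(2) pr by (auto simp: f_op_def split: if_splits)
  qed
  then show ?thesis using assms(2) by (auto simp: incr_seqs_def f_op_def split: if_splits)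
qed

lemma e_op_apply:
  "e_op I i T = Some U \<Longrightarrow> p \<in> I \<Longrightarrow> U p = (if T p = i + 1 then i else T p)"
  by (auto simp: e_op_def split: if_splits)

lemma f_op_apply:
  "f_op I i T = Some U \<Longrightarrow> p \<in> I \<Longrightarrow> U p = (if T p = i then i + 1 else T p)"
  by (auto simp: f_op_def split: if_splits)

lemma op_apply_eq:
  assumes "e_op I i T = Some U \<or> f_op I i T = Some U" "p \<in> I" "T p = p" "p \<notin> {i, i + 1}"
  shows "U p = p"
  using assms(1)
proof
  assume "e_op I i T = Some U"
  from e_op_apply[OF this assms(2)] show ?thesis using assms by simp
next
  assume "f_op I i T = Some U"
  from f_op_apply[OF this assms(2)] show ?thesis using assms by simp
qed

lemma op_T_plus:
  assumes "T \<in> T_plus l" "e_op {..l} i T = Some U \<or> f_op {..l} i T = Some U"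
  shows "U \<in> T_plus l"
proof -
  have "\<forall>\<^sub>F p in at_bot. T p = p" using assms(1) by (simp add: T_plus_def)
  then have "\<forall>\<^sub>F p in at_bot. U p = p"
    using eventually_le_at_bot[of "min l (i - 1)"]
    by eventually_elim (rule op_apply_eq[OF assms(2)], auto)
  moreover have "U \<in> incr_seqs {..l}"
    using assms e_op_incr_seqs f_op_incr_seqs unfolding T_plus_def by blast
  ultimately show ?thesis by (simp add: T_plus_def)
qed

lemma op_T_minus:
  assumes "T \<in> T_minus" "e_op {1..} i T = Some U \<or> f_op {1..} i T = Some U"
  shows "U \<in> T_minus"
proof -
  have "\<forall>\<^sub>F p in at_top. T p = p" using assms(1) by (simp add: T_minus_def)
  then have "\<forall>\<^sub>F p in at_top. U p = p"
    using eventually_ge_at_top[of "max 1 (i + 2)"]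
    by eventually_elim (rule op_apply_eq[OF assms(2)], auto)
  moreover have "U \<in> incr_seqs {1..}"
    using assms e_op_incr_seqs f_op_incr_seqs unfolding T_minus_def by blast
  ultimately show ?thesis by (simp add: T_minus_def)
qed

lemma seq_vec_in_free_space:
  assumes "\<And>U. T = Some U \<Longrightarrow> U \<in> B"
  shows "seq_vec T \<in> free_space B"
  using assms by (auto simp: seq_vec_def split: option.splits)

lemma seq_vec_None [simp]: "seq_vec None = 0"
  by (simp add: seq_vec_def)

text \<open>Compares sequences with different index sets that share only the fibre over y, as
  \<Pi>(S \<otimes> S') does with S or S'.\<close>

lemma image_mem_cong:
  assumes "\<And>p. p \<in> A \<and> f p = y \<longleftrightarrow> p \<in> B \<and> g p = y"
  shows "y \<in> f ` A \<longleftrightarrow> y \<in> g ` B"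
  unfolding image_iff Bex_def eq_commute[of y] by (simp only: assms)

section \<open>Admissible pairs and the cut at \<alpha>\<close>

locale seq_pair =
  fixes l :: int and S S' :: seq
  assumes pair: "(S, S') \<in> T_pairs l"
begin

abbreviation \<alpha> :: int where "\<alpha> \<equiv> alpha_idx l S"

abbreviation R :: seq where "R \<equiv> Pi_map l (S, S')"

lemma S: "S \<in> T_plus l" and S': "S' \<in> T_minus"
  using pair by (auto simp: T_pairs_def)

lemma alpha_le: "\<alpha> \<le> l"
  by (rule alpha_idx(1)[OF S])

lemma alpha_nonneg: "\<alpha> \<ge> 0"
  using pair beta_idx(1)[OF S'] by (auto simp: T_pairs_def)

lemma S_eq_iff: "p \<le> l \<Longrightarrow> S p = p \<longleftrightarrow> p \<le> \<alpha>"
  by (rule alpha_idx(2)[OF S])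

lemma S_ge: "p \<le> l \<Longrightarrow> p \<le> S p"
  by (rule T_plus_ge[OF S])

lemma S'_le: "1 \<le> p \<Longrightarrow> S' p \<le> p"
  by (rule T_minus_le[OF S'])

text \<open>This is where admissibility enters: an index beyond \<alpha> is at least the \<beta> of
  S', from where on S' is the identity.\<close>

lemma S'_eq: "\<alpha> < p \<Longrightarrow> S' p = p"
  using pair beta_idx(2)[OF S', of p] alpha_nonneg by (auto simp: T_pairs_def)

lemma R_apply: "1 \<le> p \<Longrightarrow> p \<le> l \<Longrightarrow> R p = (if p \<le> \<alpha> then S' p else S p)"
  by (simp add: Pi_map_def)

text \<open>Up to \<alpha> the entry at p is p; beyond \<alpha> it exceeds p, hence is at least
  \<alpha> + 2.\<close>

lemma alpha_Suc_notin_S: "\<alpha> + 1 \<notin> S ` {..l}"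
proof
  assume "\<alpha> + 1 \<in> S ` {..l}"
  then obtain p where "p \<le> l" "S p = \<alpha> + 1" by auto
  then show False using S_eq_iff[of p] S_ge[of p] by (cases "p \<le> \<alpha>") auto
qed

lemma low_in_S: "i \<le> \<alpha> \<Longrightarrow> i \<in> S ` {..l}"
  using S_eq_iff[of i] alpha_le by (intro image_eqI[of _ _ i]) auto

lemma high_in_S': "\<alpha> < i \<Longrightarrow> i \<in> S' ` {1..}"
  using S'_eq[of i] alpha_nonneg by (intro image_eqI[of _ _ i]) auto

text \<open>Values above \<alpha> can only sit at p > \<alpha>, because up to \<alpha> one has S' p
  \<le> p and S p = p. Beyond the cut, R is S.\<close>

lemma R_high: "\<alpha> < i \<Longrightarrow> p \<in> {1..l} \<and> R p = i \<longleftrightarrow> p \<le> l \<and> S p = i"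
  using R_apply[of p] S'_le[of p] S_eq_iff[of p] alpha_nonneg by (cases "p \<le> \<alpha>") auto

text \<open>Beyond \<alpha>, S p \<ge> p and S' p = p both exceed \<alpha>, so small values sit at p
  \<le> \<alpha>, where R is S'.\<close>

lemma R_low: "i \<le> \<alpha> \<Longrightarrow> p \<in> {1..l} \<and> R p = i \<longleftrightarrow> 1 \<le> p \<and> S' p = i"
  using R_apply[of p] S'_eq[of p] S_ge[of p] alpha_le by (cases "p \<le> \<alpha>") auto

lemma in_R_high: "\<alpha> < i \<Longrightarrow> i \<in> R ` {1..l} \<longleftrightarrow> i \<in> S ` {..l}"
  by (rule image_mem_cong) (use R_high in simp)

lemma in_R_low: "i \<le> \<alpha> \<Longrightarrow> i \<in> R ` {1..l} \<longleftrightarrow> i \<in> S' ` {1..}"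
  by (rule image_mem_cong) (use R_low in simp)

lemma alpha_Suc_notin_R: "\<alpha> + 1 \<notin> R ` {1..l}"
  using in_R_high[of "\<alpha> + 1"] alpha_Suc_notin_S by simp

lemma alpha_in_S':
  assumes "\<alpha> \<in> S' ` {1..}"
  shows "S' \<alpha> = \<alpha>" "1 \<le> \<alpha>"
proof -
  from assms obtain p where "1 \<le> p" "S' p = \<alpha>" by auto
  with S'_le[of p] S'_eq[of p] have "p = \<alpha>" by (cases "\<alpha> < p") auto
  with \<open>1 \<le> p\<close> \<open>S' p = \<alpha>\<close> show "S' \<alpha> = \<alpha>" "1 \<le> \<alpha>" by auto
qed

lemma S_eq_alpha: "p \<le> l \<and> S p = \<alpha> \<longleftrightarrow> p = \<alpha>"
  using S_eq_iff[of p] S_ge[of p] S_eq_iff[of \<alpha>] alpha_le by (cases "p \<le> \<alpha>") auto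

text \<open>If S' contains \<alpha>, then S, S' and R all have it exactly at index \<alpha>; this
  value can then be handled through S although R takes it from S'.\<close>

lemma R_alpha:
  assumes "\<alpha> \<in> S' ` {1..}"
  shows "p \<in> {1..l} \<and> R p = \<alpha> \<longleftrightarrow> p \<le> l \<and> S p = \<alpha>"
proof -
  have "1 \<le> p \<and> S' p = \<alpha> \<longleftrightarrow> p = \<alpha>"
    using alpha_in_S'[OF assms] S'_le[of p] S'_eq[of p] by (cases "\<alpha> < p") auto
  then show ?thesis using R_low[of \<alpha> p] S_eq_alpha by simp
qed

text \<open>An operator on S can move the cut. Hence \<open>low\<close> refers to the cut of U,
  while \<open>high\<close> starts beyond the old one.\<close>

lemma replace_S:
  assumes U: "U \<in> T_plus l" and "alpha_idx l U \<ge> beta_idx S' - 1"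
    and low: "\<And>p. 1 \<le> p \<Longrightarrow> p \<le> \<alpha> \<Longrightarrow> V p = (if p \<le> alpha_idx l U then S' p else U p)"
    and high: "\<And>p. \<alpha> < p \<Longrightarrow> p \<le> l \<Longrightarrow> V p = U p"
    and V: "V \<in> extensional {1..l}"
  shows "(U, S') \<in> T_pairs l" "V = Pi_map l (U, S')"
proof -
  show "(U, S') \<in> T_pairs l" using assms(2) U S' by (simp add: T_pairs_def)
  show "V = Pi_map l (U, S')"
  proof
    fix p
    \<comment> \<open>If the cut has moved to the right, the stretch in between is harmless: there U
      and S' are both the identity.\<close>
    have "U p = S' p" if "\<alpha> < p" "p \<le> alpha_idx l U" "p \<le> l"
      using that alpha_idx(2)[OF U, of p] S'_eq[of p] by simp
    then show "V p = Pi_map l (U, S') p"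
      using low[of p] high[of p] V
      by (cases "p \<in> {1..l}"; cases "p \<le> \<alpha>") (auto simp: Pi_map_def extensional_def)
  qed
qed

lemma e_op_high:
  assumes "\<alpha> < i" "e_op {..l} i S = Some U"
  shows "(U, S') \<in> T_pairs l" "e_op {1..l} i R = Some (Pi_map l (U, S'))"
proof -
  have U: "U \<in> T_plus l" using op_T_plus[OF S] assms(2) by blast
  have "e_op {1..l} i R \<noteq> None"
    using assms(2) in_R_high[of i] in_R_high[of "i + 1"] \<open>\<alpha> < i\<close> by (auto simp: e_op_def split: if_splits)
  then obtain V where V: "e_op {1..l} i R = Some V" by auto
  \<comment> \<open>Only the value i + 1 > \<alpha> changes, so \<alpha> stays on the diagonal and
    the cut cannot move left.\<close>
  have "U \<alpha> = \<alpha>"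
    using e_op_apply[OF assms(2), of \<alpha>] S_eq_iff[of \<alpha>] alpha_le assms(1) by simp
  then have \<alpha>U: "\<alpha> \<le> alpha_idx l U" using alpha_idx(2)[OF U, of \<alpha>] alpha_le by simp
  then have 1: "alpha_idx l U \<ge> beta_idx S' - 1" using pair by (simp add: T_pairs_def)
  have 2: "V p = (if p \<le> alpha_idx l U then S' p else U p)" if "1 \<le> p" "p \<le> \<alpha>" for p
    using that \<alpha>U e_op_apply[OF V, of p] R_apply[of p] alpha_le S'_le[of p] assms(1) by simp
  have 3: "V p = U p" if "\<alpha> < p" "p \<le> l" for p
    using that e_op_apply[OF V, of p] e_op_apply[OF assms(2), of p] R_apply[of p] alpha_nonneg by simp
  have 4: "V \<in> extensional {1..l}" using V by (auto simp: e_op_def split: if_splits)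
  show "(U, S') \<in> T_pairs l" "e_op {1..l} i R = Some (Pi_map l (U, S'))"
    using replace_S[OF U 1 2 3 4] V by auto
qed

lemma f_op_high:
  assumes "\<alpha> < i \<or> i = \<alpha> \<and> \<alpha> \<in> S' ` {1..}" "f_op {..l} i S = Some U"
  shows "(U, S') \<in> T_pairs l" "f_op {1..l} i R = Some (Pi_map l (U, S'))"
proof -
  have U: "U \<in> T_plus l" using op_T_plus[OF S] assms(2) by blast
  have "f_op {1..l} i R \<noteq> None"
    using assms in_R_high[of i] in_R_high[of "i + 1"] in_R_low[of i]
    by (auto simp: f_op_def split: if_splits)
  then obtain V where V: "f_op {1..l} i R = Some V" by auto
  have "\<alpha> \<le> i" using assms(1) by auto
  \<comment> \<open>Up to \<alpha> \<le> i, S is the identity, so only p = i can leave the diagonal: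
    for i = \<alpha> the cut drops to \<alpha> - 1, otherwise it does not drop.\<close>
  then have *: "p \<le> alpha_idx l U \<longleftrightarrow> p < i" if "p \<le> \<alpha>" for p
    using f_op_apply[OF assms(2), of p] that S_eq_iff[of p] alpha_le alpha_idx(2)[OF U, of p]
    by (auto split: if_splits)
  have 1: "alpha_idx l U \<ge> beta_idx S' - 1"
  proof (cases "\<alpha> < i")
    case True
    then show ?thesis using *[of \<alpha>] pair by (simp add: T_pairs_def)
  next
    case False
    \<comment> \<open>The dropped cut is still admissible: S' fixes \<alpha>, hence its \<beta> is
      at most \<alpha>.\<close>
    with assms(1) have "i = \<alpha>" "\<alpha> \<in> S' ` {1..}" by auto
    then show ?thesis using *[of "\<alpha> - 1"] alpha_in_S' beta_idx(2)[OF S', of \<alpha>] by simp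
  qed
  have 2: "V p = (if p \<le> alpha_idx l U then S' p else U p)" if "1 \<le> p" "p \<le> \<alpha>" for p
    using that *[of p] f_op_apply[OF V, of p] f_op_apply[OF assms(2), of p] R_apply[of p] alpha_le
      S'_le[of p] S_eq_iff[of p] alpha_in_S' assms(1) by auto
  have 3: "V p = U p" if "\<alpha> < p" "p \<le> l" for p
    using that f_op_apply[OF V, of p] f_op_apply[OF assms(2), of p] R_apply[of p] alpha_nonneg by simp
  have 4: "V \<in> extensional {1..l}" using V by (auto simp: f_op_def split: if_splits)
  show "(U, S') \<in> T_pairs l" "f_op {1..l} i R = Some (Pi_map l (U, S'))"
    using replace_S[OF U 1 2 3 4] V by auto
qed

text \<open>Here S and hence the cut stay the same; that U fixes \<alpha> + 1 says that its \<beta>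
  is at most \<alpha> + 1, which is admissibility.\<close>

lemma replace_S':
  assumes U: "U \<in> T_minus" and "U (\<alpha> + 1) = \<alpha> + 1"
    and low: "\<And>p. 1 \<le> p \<Longrightarrow> p \<le> \<alpha> \<Longrightarrow> V p = U p"
    and high: "\<And>p. \<alpha> < p \<Longrightarrow> p \<le> l \<Longrightarrow> V p = S p"
    and V: "V \<in> extensional {1..l}"
  shows "(S, U) \<in> T_pairs l" "V = Pi_map l (S, U)"
proof -
  show "(S, U) \<in> T_pairs l"
    using assms(2) beta_idx(2)[OF U, of "\<alpha> + 1"] alpha_nonneg U S by (simp add: T_pairs_def)
  show "V = Pi_map l (S, U)"
  proof
    fix p
    show "V p = Pi_map l (S, U) p"
      using low[of p] high[of p] V by (cases "p \<in> {1..l}") (auto simp: Pi_map_def extensional_def)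
  qed
qed

lemma e_op_low:
  assumes "i < \<alpha>" "e_op {1..} i S' = Some U"
  shows "(S, U) \<in> T_pairs l" "e_op {1..l} i R = Some (Pi_map l (S, U))"
proof -
  have U: "U \<in> T_minus" using op_T_minus[OF S'] assms(2) by blast
  have "e_op {1..l} i R \<noteq> None"
    using assms in_R_low[of i] in_R_low[of "i + 1"] by (auto simp: e_op_def split: if_splits)
  then obtain V where V: "e_op {1..l} i R = Some V" by auto
  have 1: "U (\<alpha> + 1) = \<alpha> + 1"
    using e_op_apply[OF assms(2), of "\<alpha> + 1"] S'_eq[of "\<alpha> + 1"] alpha_nonneg assms(1) by simp
  have 2: "V p = U p" if "1 \<le> p" "p \<le> \<alpha>" for p
    using that e_op_apply[OF V, of p] e_op_apply[OF assms(2), of p] R_apply[of p] alpha_le by simp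
  have 3: "V p = S p" if "\<alpha> < p" "p \<le> l" for p
    using that e_op_apply[OF V, of p] R_apply[of p] S_ge[of p] alpha_nonneg assms(1) by simp
  have 4: "V \<in> extensional {1..l}" using V by (auto simp: e_op_def split: if_splits)
  show "(S, U) \<in> T_pairs l" "e_op {1..l} i R = Some (Pi_map l (S, U))"
    using replace_S'[OF U 1 2 3 4] V by auto
qed

lemma f_op_low:
  assumes "i < \<alpha>" "f_op {1..} i S' = Some U"
  shows "(S, U) \<in> T_pairs l" "f_op {1..l} i R = Some (Pi_map l (S, U))"
proof -
  have U: "U \<in> T_minus" using op_T_minus[OF S'] assms(2) by blast
  have "f_op {1..l} i R \<noteq> None"
    using assms in_R_low[of i] in_R_low[of "i + 1"] by (auto simp: f_op_def split: if_splits)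
  then obtain V where V: "f_op {1..l} i R = Some V" by auto
  have 1: "U (\<alpha> + 1) = \<alpha> + 1"
    using f_op_apply[OF assms(2), of "\<alpha> + 1"] S'_eq[of "\<alpha> + 1"] alpha_nonneg assms(1) by simp
  have 2: "V p = U p" if "1 \<le> p" "p \<le> \<alpha>" for p
    using that f_op_apply[OF V, of p] f_op_apply[OF assms(2), of p] R_apply[of p] alpha_le by simp
  have 3: "V p = S p" if "\<alpha> < p" "p \<le> l" for p
    using that f_op_apply[OF V, of p] R_apply[of p] S_ge[of p] alpha_nonneg assms(1) by simp
  have 4: "V \<in> extensional {1..l}" using V by (auto simp: f_op_def split: if_splits)
  show "(S, U) \<in> T_pairs l" "f_op {1..l} i R = Some (Pi_map l (S, U))"
    using replace_S'[OF U 1 2 3 4] V by auto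
qed

end

section \<open>Basis vectors of the extremal module under the operators\<close>

lemma extremal_vec_None [simp]: "extremal_vec l None = 0"
  by (simp add: extremal_vec_def)

lemma extremal_vec_Pi_map:
  assumes "l \<ge> 1" "(S, S') \<in> T_pairs l"
  shows "extremal_vec l (Some (Pi_map l (S, S'))) = basis_vec (S, S')"
  using bij_betw_imp_inj_on[OF bij_Pi_map[OF assms(1)]] assms(2) by (simp add: extremal_vec_def)

context seq_pair
begin

lemma extremal_vec_e_op_high:
  assumes "l \<ge> 1" "\<alpha> < i"
  shows "extremal_vec l (e_op {1..l} i R) = tensor (seq_vec (e_op {..l} i S)) (basis_vec S')"
proof (cases "e_op {..l} i S")
  case None
  then have "e_op {1..l} i R = None"
    using in_R_high[of i] in_R_high[of "i + 1"] assms by (auto simp: e_op_def split: if_splits)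
  with None show ?thesis by simp
next
  case (Some U)
  then show ?thesis
    using e_op_high[OF assms(2)] extremal_vec_Pi_map[OF assms(1)] by (simp add: seq_vec_def)
qed

lemma extremal_vec_f_op_high:
  assumes "l \<ge> 1" "\<alpha> < i \<or> i = \<alpha> \<and> \<alpha> \<in> S' ` {1..}"
  shows "extremal_vec l (f_op {1..l} i R) = tensor (seq_vec (f_op {..l} i S)) (basis_vec S')"
proof (cases "f_op {..l} i S")
  case None
  then have "f_op {1..l} i R = None"
    using in_R_high[of i] in_R_high[of "i + 1"] low_in_S[of i] assms(2)
    by (auto simp: f_op_def split: if_splits)
  with None show ?thesis by simp
next
  case (Some U)
  then show ?thesis
    using f_op_high[OF assms(2)] extremal_vec_Pi_map[OF assms(1)] by (simp add: seq_vec_def)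
qed

lemma extremal_vec_e_op_low:
  assumes "l \<ge> 1" "i < \<alpha>"
  shows "extremal_vec l (e_op {1..l} i R) = tensor (basis_vec S) (seq_vec (e_op {1..} i S'))"
proof (cases "e_op {1..} i S'")
  case None
  then have "e_op {1..l} i R = None"
    using in_R_low[of i] in_R_low[of "i + 1"] assms by (auto simp: e_op_def split: if_splits)
  with None show ?thesis by simp
next
  case (Some U)
  then show ?thesis
    using e_op_low[OF assms(2)] extremal_vec_Pi_map[OF assms(1)] by (simp add: seq_vec_def)
qed

lemma extremal_vec_f_op_low:
  assumes "l \<ge> 1" "i < \<alpha>"
  shows "extremal_vec l (f_op {1..l} i R) = tensor (basis_vec S) (seq_vec (f_op {1..} i S'))"
proof (cases "f_op {1..} i S'")
  case None
  then have "f_op {1..l} i R = None"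
    using in_R_low[of i] in_R_low[of "i + 1"] assms by (auto simp: f_op_def split: if_splits)
  with None show ?thesis by simp
next
  case (Some U)
  then show ?thesis
    using f_op_low[OF assms(2)] extremal_vec_Pi_map[OF assms(1)] by (simp add: seq_vec_def)
qed

end

section \<open>The Drinfeld tensor product\<close>

lemmas drinfeld_tensorD =
  drinfeld_tensor_def[THEN iffD1, THEN conjunct2, THEN bspec, THEN bspec, THEN spec, THEN conjunct1]
  drinfeld_tensor_def[THEN iffD1, THEN conjunct2, THEN bspec, THEN bspec, THEN spec, THEN conjunct2, THEN conjunct1]
  drinfeld_tensor_def[THEN iffD1, THEN conjunct2, THEN bspec, THEN bspec, THEN spec, THEN conjunct2, THEN conjunct2]

text \<open>\<open>h\<close> is left abstract so that one lemma covers a factor with eigenvalue 1 on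
  either side and the cancelling pair \<psi>, \<psi>^{-1}.\<close>

lemma drinfeld_phi:
  assumes D: "drinfeld_tensor t B1 act1 B2 act2 act"
    and uv: "u \<in> free_space B1" "v \<in> free_space B2"
    and f: "phi_acts_by t act1 \<epsilon> i u f" and g: "phi_acts_by t act2 \<epsilon> i v g"
    and h: "\<And>n. (\<Sum>m = min 0 n..max 0 n. expand \<epsilon> f m * expand \<epsilon> g (n - m)) = expand \<epsilon> h n"
  shows "phi_acts_by t act \<epsilon> i (tensor u v) h"
  unfolding phi_acts_by_def
proof
  fix n
  have "act (phi_coeff t \<epsilon> i n) (tensor u v) = (\<Sum>m = min 0 n..max 0 n.
      tensor (act1 (phi_coeff t \<epsilon> i m) u) (act2 (phi_coeff t \<epsilon> i (n - m)) v))"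
    using drinfeld_tensorD(1)[OF D uv, of i] by blast
  also have "\<dots> = (\<Sum>m = min 0 n..max 0 n. scale (expand \<epsilon> f m * expand \<epsilon> g (n - m)) (tensor u v))"
    using f g by (simp add: phi_acts_by_def tensor_scale_left tensor_scale_right mult.commute)
  also have "\<dots> = scale (expand \<epsilon> h n) (tensor u v)"
    by (simp add: scale_sum_left[symmetric] h)
  finally show "act (phi_coeff t \<epsilon> i n) (tensor u v) = scale (expand \<epsilon> h n) (tensor u v)" .
qed

lemma convolution_1_left:
  "(\<Sum>m = min 0 n..max 0 n. expand \<epsilon> 1 m * expand \<epsilon> f (n - m)) = expand \<epsilon> f n"
proof -
  have "(\<Sum>m = min 0 n..max 0 n. expand \<epsilon> 1 m * expand \<epsilon> f (n - m)) =
      (\<Sum>m\<in>{min 0 n..max 0 n}. if m = 0 then expand \<epsilon> f n else 0)"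
    by (intro sum.cong) (auto simp: expand_1)
  then show ?thesis by (simp add: sum.delta')
qed

lemma convolution_1_right:
  "(\<Sum>m = min 0 n..max 0 n. expand \<epsilon> f m * expand \<epsilon> 1 (n - m)) = expand \<epsilon> f n"
proof -
  have "(\<Sum>m = min 0 n..max 0 n. expand \<epsilon> f m * expand \<epsilon> 1 (n - m)) =
      (\<Sum>m\<in>{min 0 n..max 0 n}. if m = n then expand \<epsilon> f n else 0)"
    by (intro sum.cong) (auto simp: expand_1)
  then show ?thesis by (simp add: sum.delta')
qed

text \<open>The coproduct is phrased through sets of spectral parameters, the modules through
  positions; injectivity keeps distinct positions from merging.\<close>

lemma is_delta_sum_image:
  assumes "\<And>r. D r = (\<Sum>p\<in>P. scale (delta (c p) r) w)"
    and "finite P" "inj_on c P" "\<And>p. p \<in> P \<Longrightarrow> c p \<noteq> 0"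
  shows "is_delta_sum D (c ` P) (\<lambda>_. w)"
  using assms by (auto simp: is_delta_sum_def sum.reindex)

lemma drinfeld_x_pos:
  assumes D: "drinfeld_tensor t B1 act1 B2 act2 act"
    and uv: "u \<in> free_space B1" "v \<in> free_space B2"
    and f: "phi_acts_by t act1 Neg i u f"
    and x: "\<And>r. act2 (x_coeff t Pos i r) v = (\<Sum>p\<in>P. scale (delta (c p) r) w)"
    and P: "finite P" "inj_on c P" "\<And>p. p \<in> P \<Longrightarrow> c p \<noteq> 0"
    and w: "w \<in> free_space B2"
    and pole: "\<And>p. p \<in> P \<Longrightarrow> \<not> rat_pole f (inverse (c p))"
  shows "act (x_coeff t Pos i r) (tensor u v) = tensor (act1 (x_coeff t Pos i r) u) v +
    (\<Sum>p\<in>P. scale (rat_eval f (inverse (c p)) * delta (c p) r) (tensor u w))"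
proof -
  have "phi_acts_by t act1 Neg i u f \<and>
      is_delta_sum (\<lambda>r. act2 (x_coeff t Pos i r) v) (c ` P) (\<lambda>_. w) \<and>
      (\<forall>d\<in>c ` P. w \<in> free_space B2 \<and> \<not> rat_pole f (inverse d))"
    using f is_delta_sum_image[OF x P] w pole by blast
  then have "act (x_coeff t Pos i r) (tensor u v) = tensor (act1 (x_coeff t Pos i r) u) v +
      (\<Sum>d\<in>c ` P. scale (rat_eval f (inverse d) * delta d r) (tensor u w))"
    using drinfeld_tensorD(2)[OF D uv, of i, THEN spec[of _ f], THEN spec[of _ "c ` P"],
        THEN spec[of _ "\<lambda>_. w"]] by blast
  then show ?thesis by (simp add: sum.reindex[OF P(2)])
qed

lemma drinfeld_x_neg:
  assumes D: "drinfeld_tensor t B1 act1 B2 act2 act"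
    and uv: "u \<in> free_space B1" "v \<in> free_space B2"
    and f: "phi_acts_by t act2 Pos i v f"
    and x: "\<And>r. act1 (x_coeff t Neg i r) u = (\<Sum>p\<in>P. scale (delta (c p) r) w)"
    and P: "finite P" "inj_on c P" "\<And>p. p \<in> P \<Longrightarrow> c p \<noteq> 0"
    and w: "w \<in> free_space B1"
    and pole: "\<And>p. p \<in> P \<Longrightarrow> \<not> rat_pole f (inverse (c p))"
  shows "act (x_coeff t Neg i r) (tensor u v) =
    (\<Sum>p\<in>P. scale (rat_eval f (inverse (c p)) * delta (c p) r) (tensor w v)) +
    tensor u (act2 (x_coeff t Neg i r) v)"
proof -
  have "phi_acts_by t act2 Pos i v f \<and>
      is_delta_sum (\<lambda>r. act1 (x_coeff t Neg i r) u) (c ` P) (\<lambda>_. w) \<and>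
      (\<forall>d\<in>c ` P. w \<in> free_space B1 \<and> \<not> rat_pole f (inverse d))"
    using f is_delta_sum_image[OF x P] w pole by blast
  then have "act (x_coeff t Neg i r) (tensor u v) =
      (\<Sum>d\<in>c ` P. scale (rat_eval f (inverse d) * delta d r) (tensor w v)) +
      tensor u (act2 (x_coeff t Neg i r) v)"
    using drinfeld_tensorD(3)[OF D uv, of i, THEN spec[of _ f], THEN spec[of _ "c ` P"],
        THEN spec[of _ "\<lambda>_. w"]] by blast
  then show ?thesis by (simp add: sum.reindex[OF P(2)])
qed

text \<open>The value is \<psi>(q^2), whose numerator q - q^{-1} q^2 is 0; q^2 \<noteq> 1 keeps the
  denominator 1 - q^2 nonzero.\<close>

lemma psi_zero:
  assumes "d \<noteq> 0" "c = d * exp t ^ 2" "exp t ^ 2 \<noteq> 1"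
  shows "\<not> rat_pole (psi t c) (inverse d)" "rat_eval (psi t c) (inverse d) = 0"
proof -
  have nz: "poly [:1, - c:] (inverse d) \<noteq> 0" using assms by (simp add: field_simps)
  show "\<not> rat_pole (psi t c) (inverse d)"
    unfolding psi_def by (rule not_rat_pole_Fract[OF nz])
  show "rat_eval (psi t c) (inverse d) = 0"
    unfolding psi_def rat_eval_Fract[OF nz] using assms by (simp add: field_simps power2_eq_square)
qed

text \<open>The value is \<psi>(1)^{-1}: the numerator is 1 - 1 and the denominator q - q^{-1},
  which is nonzero by q^2 \<noteq> 1.\<close>

lemma inverse_psi_zero:
  assumes "c \<noteq> 0" "exp t ^ 2 \<noteq> 1"
  shows "\<not> rat_pole (inverse (psi t c)) (inverse c)" "rat_eval (inverse (psi t c)) (inverse c) = 0"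
proof -
  have nz: "poly [:exp t, - (inverse (exp t) * c):] (inverse c) \<noteq> 0"
    using assms by (simp add: field_simps power2_eq_square)
  show "\<not> rat_pole (inverse (psi t c)) (inverse c)"
    unfolding inverse_psi by (rule not_rat_pole_Fract[OF nz])
  show "rat_eval (inverse (psi t c)) (inverse c) = 0"
    unfolding inverse_psi rat_eval_Fract[OF nz] using assms by simp
qed

text \<open>An increasing sequence takes a value at most once, so the fibre is empty or a singleton
  and every \<open>c\<close> is injective on it.\<close>

lemma incr_seqs_fibre:
  assumes "T \<in> incr_seqs I"
  shows "finite {p. p \<in> I \<and> T p = j}" "inj_on c {p. p \<in> I \<and> T p = j}"
proof -
  have *: "inj_on T I" using assms by (simp add: incr_seqs_def strict_mono_on_imp_inj_on)
  have "finite {p. p \<in> I \<and> T p = j} \<and> inj_on c {p. p \<in> I \<and> T p = j}"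
  proof (cases "\<exists>p. p \<in> I \<and> T p = j")
    case True
    then obtain p where "p \<in> I" "T p = j" by blast
    with * have "{p. p \<in> I \<and> T p = j} = {p}" by (auto dest: inj_onD)
    then show ?thesis by simp
  next
    case False
    then have "{p. p \<in> I \<and> T p = j} = {}" by blast
    then show ?thesis by (simp only: finite.emptyI inj_on_empty simp_thms)
  qed
  then show "finite {p. p \<in> I \<and> T p = j}" "inj_on c {p. p \<in> I \<and> T p = j}" by simp_all
qed

text \<open>Common shape of the eigenvalue clauses of both fundamental modules and of the target.
  Sequence and vector are separate arguments, so that the clauses can be carried from a factor to
  the tensor product.\<close>

definition phi_rule ::
  "complex \<Rightarrow> 'b action \<Rightarrow> int set \<Rightarrow> int \<Rightarrow> complex \<Rightarrow> int \<Rightarrow> seq \<Rightarrow> ('b \<Rightarrow>\<^sub>0 complex) \<Rightarrow> bool" where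
  "phi_rule t act I N b i T v \<longleftrightarrow> (\<forall>\<epsilon>.
     (\<forall>p\<in>I. T p = i + 1 \<and> i \<notin> T ` I \<longrightarrow>
        phi_acts_by t act \<epsilon> i v (inverse (psi t (b * exp t powi (i + N + 3 - 2 * p))))) \<and>
     (\<forall>p\<in>I. T p = i \<and> i + 1 \<notin> T ` I \<longrightarrow>
        phi_acts_by t act \<epsilon> i v (psi t (b * exp t powi (i + N + 1 - 2 * p)))) \<and>
     ((i \<in> T ` I \<longleftrightarrow> i + 1 \<in> T ` I) \<longrightarrow> phi_acts_by t act \<epsilon> i v 1))"

lemma phi_ruleI:
  assumes "\<And>\<epsilon> p. p \<in> I \<Longrightarrow> T p = i + 1 \<Longrightarrow> i \<notin> T ` I \<Longrightarrow>
      phi_acts_by t act \<epsilon> i v (inverse (psi t (b * exp t powi (i + N + 3 - 2 * p))))"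
    and "\<And>\<epsilon> p. p \<in> I \<Longrightarrow> T p = i \<Longrightarrow> i + 1 \<notin> T ` I \<Longrightarrow>
      phi_acts_by t act \<epsilon> i v (psi t (b * exp t powi (i + N + 1 - 2 * p)))"
    and "\<And>\<epsilon>. (i \<in> T ` I \<longleftrightarrow> i + 1 \<in> T ` I) \<Longrightarrow> phi_acts_by t act \<epsilon> i v 1"
  shows "phi_rule t act I N b i T v"
  unfolding phi_rule_def by (intro allI conjI ballI impI; (elim conjE)?) (rule assms; assumption)+

lemma phi_ruleD:
  assumes "phi_rule t act I N b i T v"
  shows "p \<in> I \<Longrightarrow> T p = i + 1 \<Longrightarrow> i \<notin> T ` I \<Longrightarrow>
      phi_acts_by t act \<epsilon> i v (inverse (psi t (b * exp t powi (i + N + 3 - 2 * p))))"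
    and "p \<in> I \<Longrightarrow> T p = i \<Longrightarrow> i + 1 \<notin> T ` I \<Longrightarrow>
      phi_acts_by t act \<epsilon> i v (psi t (b * exp t powi (i + N + 1 - 2 * p)))"
    and "(i \<in> T ` I \<longleftrightarrow> i + 1 \<in> T ` I) \<Longrightarrow> phi_acts_by t act \<epsilon> i v 1"
  using assms unfolding phi_rule_def by blast+

text \<open>The eigenvalue depends only on the positions of i and i + 1; \<open>step\<close> will be
  tensoring with a vector on which the current acts by 1.\<close>

lemma phi_rule_transfer:
  assumes "phi_rule t act1 J N b i U v"
    and fibre: "\<And>j p. j \<in> {i, i + 1} \<Longrightarrow> p \<in> I \<and> T p = j \<longleftrightarrow> p \<in> J \<and> U p = j"
    and step: "\<And>\<epsilon> f. phi_acts_by t act1 \<epsilon> i v f \<Longrightarrow> phi_acts_by t act \<epsilon> i w f"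
  shows "phi_rule t act I N b i T w"
proof -
  have img: "i \<in> T ` I \<longleftrightarrow> i \<in> U ` J" "i + 1 \<in> T ` I \<longleftrightarrow> i + 1 \<in> U ` J"
    by (rule image_mem_cong, rule fibre, simp)+
  show ?thesis
  proof (rule phi_ruleI)
    fix \<epsilon> p assume "p \<in> I" "T p = i + 1" "i \<notin> T ` I"
    then have "p \<in> J" "U p = i + 1" "i \<notin> U ` J" using fibre[of "i + 1" p] img by auto
    then show "phi_acts_by t act \<epsilon> i w (inverse (psi t (b * exp t powi (i + N + 3 - 2 * p))))"
      by (rule step[OF phi_ruleD(1)[OF assms(1)]])
  next
    fix \<epsilon> p assume "p \<in> I" "T p = i" "i + 1 \<notin> T ` I"
    then have "p \<in> J" "U p = i" "i + 1 \<notin> U ` J" using fibre[of i p] img by auto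
    then show "phi_acts_by t act \<epsilon> i w (psi t (b * exp t powi (i + N + 1 - 2 * p)))"
      by (rule step[OF phi_ruleD(2)[OF assms(1)]])
  next
    fix \<epsilon> assume "i \<in> T ` I \<longleftrightarrow> i + 1 \<in> T ` I"
    then have "i \<in> U ` J \<longleftrightarrow> i + 1 \<in> U ` J" using img by simp
    then show "phi_acts_by t act \<epsilon> i w 1" by (rule step[OF phi_ruleD(3)[OF assms(1)]])
  qed
qed

text \<open>The coproduct clauses ask for an eigenvalue even where the term multiplied by it is
  zero.\<close>

lemma phi_rule_ex:
  assumes "phi_rule t act I N b i T v"
  obtains f where "phi_acts_by t act \<epsilon> i v f"
proof (cases "i \<in> T ` I \<longleftrightarrow> i + 1 \<in> T ` I")
  case True
  then show ?thesis by (rule that[OF phi_ruleD(3)[OF assms]])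
next
  case False
  show ?thesis
  proof (cases "i \<in> T ` I")
    case True
    then obtain p where "p \<in> I" "T p = i" by auto
    moreover have "i + 1 \<notin> T ` I" using False True by simp
    ultimately show ?thesis by (rule that[OF phi_ruleD(2)[OF assms]])
  next
    case i: False
    then obtain p where "p \<in> I" "T p = i + 1" using False by auto
    then show ?thesis using i by (rule that[OF phi_ruleD(1)[OF assms]])
  qed
qed

lemma fundamental_moduleD:
  assumes "fundamental_module t I B N b act" "T \<in> B"
  shows "act (x_coeff t Pos i r) (basis_vec T) = (\<Sum>p | p \<in> I \<and> T p = i + 1.
      scale (delta (b * exp t powi (i + N + 1 - 2 * p)) r) (seq_vec (e_op I i T)))"
    and "act (x_coeff t Neg i r) (basis_vec T) = (\<Sum>p | p \<in> I \<and> T p = i.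
      scale (delta (b * exp t powi (i + N + 1 - 2 * p)) r) (seq_vec (f_op I i T)))"
    and "phi_rule t act I N b i T (basis_vec T)"
proof -
  note * = assms(1)[unfolded fundamental_module_def, THEN conjunct2, THEN bspec, OF assms(2),
    THEN spec[of _ i]]
  show "act (x_coeff t Pos i r) (basis_vec T) = (\<Sum>p | p \<in> I \<and> T p = i + 1.
      scale (delta (b * exp t powi (i + N + 1 - 2 * p)) r) (seq_vec (e_op I i T)))"
    by (rule *[THEN conjunct1, THEN spec])
  show "act (x_coeff t Neg i r) (basis_vec T) = (\<Sum>p | p \<in> I \<and> T p = i.
      scale (delta (b * exp t powi (i + N + 1 - 2 * p)) r) (seq_vec (f_op I i T)))"
    by (rule *[THEN conjunct2, THEN conjunct1, THEN spec])
  show "phi_rule t act I N b i T (basis_vec T)"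
    unfolding phi_rule_def by (rule *[THEN conjunct2, THEN conjunct2])
qed

section \<open>The action on one admissible basis vector\<close>

locale drinfeld_pair = seq_pair l S S'
  for l :: int and S S' :: seq +
  fixes t a :: complex and act1 act2 :: "seq action" and act :: "(seq \<times> seq) action"
  assumes q2: "exp t ^ 2 \<noteq> 1"
    and l_pos: "l \<ge> 1"
    and a_nonzero: "a \<noteq> 0"
    and highest: "fundamental_highest t l a act1"
    and lowest: "fundamental_lowest t (a * exp t powi l) act2"
    and tensor: "drinfeld_tensor t (T_plus l) act1 T_minus act2 act"
begin

abbreviation "c p i \<equiv> a * exp t powi (i + l + 1 - 2 * p)"

text \<open>The factor q^l in the second parameter makes up for N = 0 in place of N = l, so that
  equal values at equal positions have equal spectral parameters on both factors.\<close>

lemma spectral: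
  "a * exp t powi l * exp t powi (i + 0 + 1 - 2 * p) = c p i"
  "a * exp t powi l * exp t powi (i + 0 + 3 - 2 * p) = a * exp t powi (i + l + 3 - 2 * p)"
proof -
  have *: "a * exp t powi l * exp t powi m = a * exp t powi n" if "n = l + m" for m n
    unfolding that by (simp add: power_int_add)
  show "a * exp t powi l * exp t powi (i + 0 + 1 - 2 * p) = c p i"
    "a * exp t powi l * exp t powi (i + 0 + 3 - 2 * p) = a * exp t powi (i + l + 3 - 2 * p)"
    by (rule *, simp)+
qed

lemmas act1 = fundamental_moduleD[OF highest[unfolded fundamental_highest_def] S]

lemmas act2 = fundamental_moduleD[OF lowest[unfolded fundamental_lowest_def] S', unfolded spectral]

lemma phi_act2: "phi_rule t act2 {1..} l a i S' (basis_vec S')"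
  using act2(3)[of i] by (simp only: phi_rule_def spectral)

lemma basis: "basis_vec S \<in> free_space (T_plus l)" "basis_vec S' \<in> free_space T_minus"
  using S S' by simp_all

lemma S_incr: "S \<in> incr_seqs {..l}" and S'_incr: "S' \<in> incr_seqs {1..}"
  using S S' by (simp_all add: T_plus_def T_minus_def)

lemma c_nonzero: "c p i \<noteq> 0"
  using a_nonzero by simp

lemma e_op_S'_free: "seq_vec (e_op {1..} i S') \<in> free_space T_minus"
  by (intro seq_vec_in_free_space op_T_minus[OF S'] disjI1)

lemma f_op_S_free: "seq_vec (f_op {..l} i S) \<in> free_space (T_plus l)"
  by (intro seq_vec_in_free_space op_T_plus[OF S] disjI2)

lemmas tensor_x_pos = drinfeld_x_pos[OF tensor basis, unfolded tensor_basis_vec]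

lemmas tensor_x_neg = drinfeld_x_neg[OF tensor basis, unfolded tensor_basis_vec]

lemmas tensor_phi = drinfeld_phi[OF tensor basis, unfolded tensor_basis_vec]

text \<open>Leaves two things to supply: the eigenvalue of \<open>\<phi>\<^sub>i\<^sup>-\<close> on
  S and its regularity at the supports of the delta functions.\<close>

lemma x_pos_act2:
  assumes f: "phi_acts_by t act1 Neg i (basis_vec S) f"
    and pole: "\<And>p. 1 \<le> p \<Longrightarrow> S' p = i + 1 \<Longrightarrow> \<not> rat_pole f (inverse (c p i))"
  shows "act (x_coeff t Pos i r) (basis_vec (S, S')) =
    tensor (act1 (x_coeff t Pos i r) (basis_vec S)) (basis_vec S') +
    (\<Sum>p | p \<in> {1..} \<and> S' p = i + 1. scale (rat_eval f (inverse (c p i)) * delta (c p i) r)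
       (tensor (basis_vec S) (seq_vec (e_op {1..} i S'))))"
  by (rule tensor_x_pos[OF f act2(1) incr_seqs_fibre[OF S'_incr] c_nonzero e_op_S'_free])
    (use pole in simp)

lemma x_neg_act1:
  assumes f: "phi_acts_by t act2 Pos i (basis_vec S') f"
    and pole: "\<And>p. p \<le> l \<Longrightarrow> S p = i \<Longrightarrow> \<not> rat_pole f (inverse (c p i))"
  shows "act (x_coeff t Neg i r) (basis_vec (S, S')) =
    (\<Sum>p | p \<in> {..l} \<and> S p = i. scale (rat_eval f (inverse (c p i)) * delta (c p i) r)
       (tensor (seq_vec (f_op {..l} i S)) (basis_vec S'))) +
    tensor (basis_vec S) (act2 (x_coeff t Neg i r) (basis_vec S'))"
  by (rule tensor_x_neg[OF f act1(2) incr_seqs_fibre[OF S_incr] c_nonzero f_op_S_free])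
    (use pole in simp)

lemma alpha_Suc_in_S':
  "\<alpha> + 1 \<in> {1..}" "S' (\<alpha> + 1) = \<alpha> + 1" "\<alpha> + 1 \<in> S' ` {1..}"
  using alpha_nonneg S'_eq[of "\<alpha> + 1"] high_in_S'[of "\<alpha> + 1"] by auto

lemma S'_eq_alpha_Suc: "1 \<le> p \<Longrightarrow> S' p = \<alpha> + 1 \<Longrightarrow> p = \<alpha> + 1"
  using S'_eq[of p] S'_le[of p] by (cases "\<alpha> < p") auto

lemma alpha_in_S: "\<alpha> \<in> {..l}" "S \<alpha> = \<alpha>"
  using alpha_le S_eq_iff[of \<alpha>] by auto

lemma phi_S_alpha: "phi_acts_by t act1 \<epsilon> \<alpha> (basis_vec S) (psi t (c \<alpha> \<alpha>))"
  using phi_ruleD(2)[OF act1(3) alpha_in_S alpha_Suc_notin_S] .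

lemma phi_S'_alpha:
  assumes "\<alpha> \<notin> S' ` {1..}"
  shows "phi_acts_by t act2 \<epsilon> \<alpha> (basis_vec S') (inverse (psi t (c \<alpha> \<alpha>)))"
proof -
  \<comment> \<open>The entry \<alpha> + 1 of S' sits one index further, which turns the shift 3
    into 1: the eigenvalue is inverse to the one on S.\<close>
  have "\<alpha> + l + 3 - 2 * (\<alpha> + 1) = \<alpha> + l + 1 - 2 * \<alpha>" by simp
  then show ?thesis
    using phi_ruleD(1)[OF phi_act2 alpha_Suc_in_S'(1,2) assms, of \<epsilon>] by metis
qed

lemma act_x_pos:
  "act (x_coeff t Pos i r) (basis_vec (S, S')) =
    (\<Sum>p | p \<in> {1..l} \<and> R p = i + 1. scale (delta (c p i) r) (extremal_vec l (e_op {1..l} i R)))"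
proof -
  consider "\<alpha> < i" | "i < \<alpha>" | "i = \<alpha>" by linarith
  then show ?thesis
  proof cases
    case 1
    \<comment> \<open>S' contains i, so the raising current kills it; the second coproduct term is
      an empty sum, whatever the eigenvalue f.\<close>
    then have "e_op {1..} i S' = None" using high_in_S' by (simp add: e_op_def)
    then have 0: "act2 (x_coeff t Pos i r) (basis_vec S') = (\<Sum>p\<in>{}. scale (delta (c p i) r) 0)" for r
      using act2(1)[of i r] by simp
    obtain f where "phi_acts_by t act1 Neg i (basis_vec S) f" by (rule phi_rule_ex[OF act1(3)])
    from tensor_x_pos[OF this 0] have "act (x_coeff t Pos i r) (basis_vec (S, S')) =
        tensor (act1 (x_coeff t Pos i r) (basis_vec S)) (basis_vec S')"
      by simp
    then show ?thesis
      using R_high[of "i + 1"] 1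
      by (simp add: act1(1) tensor_sum_left tensor_scale_left extremal_vec_e_op_high[OF l_pos])
  next
    case 2
    then have "i \<in> S ` {..l}" "i + 1 \<in> S ` {..l}" using low_in_S by auto
    then have "phi_acts_by t act1 Neg i (basis_vec S) 1" and "e_op {..l} i S = None"
      using phi_ruleD(3)[OF act1(3)] by (simp_all add: e_op_def)
    then show ?thesis
      using R_low[of "i + 1"] 2 x_pos_act2[of i 1 r]
      by (simp add: act1(1) extremal_vec_e_op_low[OF l_pos])
  next
    case 3
    \<comment> \<open>S and R miss \<alpha> + 1, so the first coproduct term and the claimed sum are
      0; the second term has to vanish through \<psi>.\<close>
    have "e_op {..l} i S = None" "e_op {1..l} i R = None"
      using alpha_Suc_notin_S alpha_Suc_notin_R 3 by (simp_all add: e_op_def)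
    moreover have "\<not> rat_pole (psi t (c \<alpha> \<alpha>)) (inverse (c p \<alpha>)) \<and>
        rat_eval (psi t (c \<alpha> \<alpha>)) (inverse (c p \<alpha>)) = 0" if "1 \<le> p" "S' p = \<alpha> + 1" for p
    proof -
      from S'_eq_alpha_Suc[OF that] have p: "p = \<alpha> + 1" .
      \<comment> \<open>Passing from index \<alpha> to \<alpha> + 1 lowers the exponent by 2, so
        \<open>psi_zero\<close> applies with d = c p \<alpha>.\<close>
      have "\<alpha> + l + 1 - 2 * \<alpha> = \<alpha> + l + 1 - 2 * p + 2" using p by simp
      then have "c \<alpha> \<alpha> = a * exp t powi (\<alpha> + l + 1 - 2 * p + 2)"
        by (simp only:)
      also have "\<dots> = c p \<alpha> * exp t ^ 2"
        by (subst power_int_add) (simp_all add: mult.assoc)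
      finally have "c \<alpha> \<alpha> = c p \<alpha> * exp t ^ 2" .
      from psi_zero[OF c_nonzero this q2] show ?thesis by blast
    qed
    ultimately show ?thesis
      using x_pos_act2[OF phi_S_alpha, of r] 3 by (simp add: act1(1))
  qed
qed

lemma act_x_neg:
  "act (x_coeff t Neg i r) (basis_vec (S, S')) =
    (\<Sum>p | p \<in> {1..l} \<and> R p = i. scale (delta (c p i) r) (extremal_vec l (f_op {1..l} i R)))"
proof -
  \<comment> \<open>A value \<alpha> present in S' is grouped with the values above \<alpha>: either
    way S' contains both i and i + 1.\<close>
  consider "\<alpha> < i \<or> i = \<alpha> \<and> \<alpha> \<in> S' ` {1..}" | "i < \<alpha>" | "i = \<alpha>" "\<alpha> \<notin> S' ` {1..}" using linorder_cases[of i \<alpha>] by blast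
  then show ?thesis
  proof cases
    case 1
    then have "i \<in> S' ` {1..}" "i + 1 \<in> S' ` {1..}" using high_in_S' by auto
    then have "phi_acts_by t act2 Pos i (basis_vec S') 1" and "f_op {1..} i S' = None"
      using phi_ruleD(3)[OF phi_act2] by (simp_all add: f_op_def)
    moreover have "p \<in> {1..l} \<and> R p = i \<longleftrightarrow> p \<in> {..l} \<and> S p = i" for p
      using 1 R_high[of i p] R_alpha[of p] by auto
    ultimately show ?thesis
      using x_neg_act1[of i 1 r] by (simp only: act2(2) extremal_vec_f_op_high[OF l_pos 1]) simp
  next
    case 2
    then have "f_op {..l} i S = None" using low_in_S by (simp add: f_op_def)
    then have 0: "act1 (x_coeff t Neg i r) (basis_vec S) = (\<Sum>p\<in>{}. scale (delta (c p i) r) 0)" for r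
      using act1(2)[of i r] by simp
    obtain f where "phi_acts_by t act2 Pos i (basis_vec S') f" by (rule phi_rule_ex[OF phi_act2])
    from tensor_x_neg[OF this 0] have "act (x_coeff t Neg i r) (basis_vec (S, S')) =
        tensor (basis_vec S) (act2 (x_coeff t Neg i r) (basis_vec S'))"
      by simp
    then show ?thesis
      using R_low[of i] 2
      by (simp add: act2(2) tensor_sum_right tensor_scale_right extremal_vec_f_op_low[OF l_pos])
  next
    case 3
    \<comment> \<open>As \<alpha> is absent from S', it is absent from R. The remaining term lowers
      \<alpha> in S at index \<alpha>, where \<psi>^{-1} is evaluated at its zero.\<close>
    have "f_op {1..} i S' = None" "f_op {1..l} i R = None"
      using alpha_Suc_in_S' in_R_low[of \<alpha>] 3 by (simp_all add: f_op_def)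
    moreover have "\<not> rat_pole (inverse (psi t (c \<alpha> \<alpha>))) (inverse (c p \<alpha>)) \<and>
        rat_eval (inverse (psi t (c \<alpha> \<alpha>))) (inverse (c p \<alpha>)) = 0" if "p \<le> l" "S p = \<alpha>" for p
      using that S_eq_alpha[of p] inverse_psi_zero[OF c_nonzero q2] by blast
    ultimately show ?thesis
      using x_neg_act1[OF phi_S'_alpha[OF 3(2)], of r] 3(1) by (simp add: act2(2))
  qed
qed

lemma act_phi: "phi_rule t act {1..l} l a i R (basis_vec (S, S'))"
proof -
  consider "\<alpha> < i" | "i < \<alpha>" | "i = \<alpha>" "\<alpha> \<in> S' ` {1..}" | "i = \<alpha>" "\<alpha> \<notin> S' ` {1..}" using linorder_cases[of i \<alpha>] by blast
  then show ?thesis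
  proof cases
    case 1
    then have "phi_acts_by t act2 \<epsilon> i (basis_vec S') 1" for \<epsilon>
      using phi_ruleD(3)[OF phi_act2] high_in_S' by simp
    then have *: "phi_acts_by t act \<epsilon> i (basis_vec (S, S')) f"
      if "phi_acts_by t act1 \<epsilon> i (basis_vec S) f" for \<epsilon> f
      using tensor_phi[OF that _ convolution_1_right] by blast
    have "p \<in> {1..l} \<and> R p = j \<longleftrightarrow> p \<in> {..l} \<and> S p = j" if "j \<in> {i, i + 1}" for j p
      using R_high[of j p] that 1 by auto
    then show ?thesis by (rule phi_rule_transfer[OF act1(3) _ *])
  next
    case 2
    then have "phi_acts_by t act1 \<epsilon> i (basis_vec S) 1" for \<epsilon>
      using phi_ruleD(3)[OF act1(3)] low_in_S by simp
    then have *: "phi_acts_by t act \<epsilon> i (basis_vec (S, S')) f"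
      if "phi_acts_by t act2 \<epsilon> i (basis_vec S') f" for \<epsilon> f
      using tensor_phi[OF _ that convolution_1_left] by blast
    have "p \<in> {1..l} \<and> R p = j \<longleftrightarrow> p \<in> {1..} \<and> S' p = j" if "j \<in> {i, i + 1}" for j p
      using R_low[of j p] that 2 by auto
    then show ?thesis by (rule phi_rule_transfer[OF phi_act2 _ *])
  next
    case 3
    then have "phi_acts_by t act2 \<epsilon> \<alpha> (basis_vec S') 1" for \<epsilon>
      using phi_ruleD(3)[OF phi_act2] alpha_Suc_in_S' by simp
    then have "phi_acts_by t act \<epsilon> \<alpha> (basis_vec (S, S')) (psi t (c \<alpha> \<alpha>))" for \<epsilon>
      using tensor_phi[OF phi_S_alpha _ convolution_1_right] by blast
    moreover have "\<alpha> \<in> R ` {1..l}" using in_R_low[of \<alpha>] 3(2) by simp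
    moreover have "p = \<alpha>" if "p \<in> {1..l}" "R p = \<alpha>" for p
      using R_alpha[OF 3(2), of p] S_eq_alpha[of p] that by blast
    ultimately show ?thesis
      unfolding 3(1) using alpha_Suc_notin_R by (intro phi_ruleI) metis+
  next
    case 4
    \<comment> \<open>The eigenvalues on the factors are mutually inverse, and R contains neither
      \<alpha> nor \<alpha> + 1, as the clause for eigenvalue 1 demands.\<close>
    have "phi_acts_by t act \<epsilon> \<alpha> (basis_vec (S, S')) 1" for \<epsilon>
      using tensor_phi[OF phi_S_alpha phi_S'_alpha[OF 4(2)] expand_psi_inverse_convolution[OF c_nonzero]] .
    moreover have "\<alpha> \<notin> R ` {1..l}" using in_R_low[of \<alpha>] 4(2) by simp
    ultimately show ?thesis
      unfolding 4(1) using alpha_Suc_notin_R imageI[of _ "{1..l}" R] by (intro phi_ruleI) metis+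
  qed
qed

end

section \<open>From one basis vector to the stated formulas\<close>

lemma extremal_action_basis_vec:
  assumes "x \<in> T_pairs l"
  shows "extremal_action l act u (basis_vec x) = act u (basis_vec x)"
  using assms by (simp add: extremal_action_def extremal_space_def)

text \<open>In a strictly increasing integer sequence i can only stand directly before i + 1; this
  turns the neighbour condition of the theorem into membership in the image.\<close>

lemma in_image_prev:
  assumes "T \<in> T_seg l" "p \<in> {1..l}" "T p = i + 1"
  shows "i \<notin> T ` {1..l} \<longleftrightarrow> p = 1 \<or> T (p - 1) \<noteq> i"
proof -
  have T: "strict_mono_on {1..l} T" using assms(1) by (simp add: T_seg_def incr_seqs_def)
  have "r = p - 1" if "r \<in> {1..l}" "T r = i" for r
  proof (rule antisym)
    have "r < p" using strict_mono_on_less[OF T that(1) assms(2)] that assms by simp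
    then show "r \<le> p - 1" by simp
    have "\<not> r < p - 1"
    proof
      \<comment> \<open>Two strict increases between r and p would make T p at least i + 2.\<close>
      assume "r < p - 1"
      then have "T r < T (p - 1)" "T (p - 1) < T p"
        using T that(1) assms(2) by (auto intro!: strict_mono_onD[OF T])
      then show False using that assms by simp
    qed
    then show "p - 1 \<le> r" by simp
  qed
  moreover have "p - 1 \<in> {1..l} \<longleftrightarrow> p \<noteq> 1" using assms(2) by auto
  ultimately show ?thesis by blast
qed

lemma in_image_next:
  assumes "T \<in> T_seg l" "p \<in> {1..l}" "T p = i"
  shows "i + 1 \<notin> T ` {1..l} \<longleftrightarrow> p = l \<or> T (p + 1) \<noteq> i + 1"
proof -
  have T: "strict_mono_on {1..l} T" using assms(1) by (simp add: T_seg_def incr_seqs_def)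
  have "r = p + 1" if "r \<in> {1..l}" "T r = i + 1" for r
  proof (rule antisym)
    have "p < r" using strict_mono_on_less[OF T assms(2) that(1)] that assms by simp
    then show "p + 1 \<le> r" by simp
    have "\<not> p + 1 < r"
    proof
      assume "p + 1 < r"
      then have "T p < T (p + 1)" "T (p + 1) < T r"
        using T that(1) assms(2) by (auto intro!: strict_mono_onD[OF T])
      then show False using that assms by simp
    qed
    then show "r \<le> p + 1" by simp
  qed
  moreover have "p + 1 \<in> {1..l} \<longleftrightarrow> p \<noteq> l" using assms(2) by auto
  ultimately show ?thesis by (metis imageE imageI)
qed

theorem theorem3p10:
  fixes t a :: complex and l :: int
    and act1 act2 :: "seq action" and act :: "(seq \<times> seq) action"
  assumes "\<forall>n::nat. n \<ge> 1 \<longrightarrow> exp t ^ n \<noteq> 1"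
    and "l \<ge> 1"
    and "a \<noteq> 0"
    and "fundamental_highest t l a act1"
    and "fundamental_lowest t (a * exp t powi l) act2"
    and "drinfeld_tensor t (T_plus l) act1 T_minus act2 act"
  shows "\<forall>T \<in> T_seg l. \<forall>i::int.
     (\<forall>r. extremal_action l act (x_coeff t Pos i r) (extremal_vec l (Some T)) =
        (\<Sum>p = 1..l. scale (of_bool (T p = i + 1) * delta (a * exp t powi (i + l + 1 - 2 * p)) r)
           (extremal_vec l (e_op {1..l} i T)))) \<and>
     (\<forall>r. extremal_action l act (x_coeff t Neg i r) (extremal_vec l (Some T)) =
        (\<Sum>p = 1..l. scale (of_bool (T p = i) * delta (a * exp t powi (i + l + 1 - 2 * p)) r)
           (extremal_vec l (f_op {1..l} i T)))) \<and>
     (\<forall>\<epsilon>.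
       (\<forall>p \<in> {1..l}. T p = i + 1 \<and> (p = 1 \<or> T (p - 1) \<noteq> i) \<longrightarrow>
          phi_acts_by t (extremal_action l act) \<epsilon> i (extremal_vec l (Some T))
            (inverse (psi t (a * exp t powi (i + l + 3 - 2 * p))))) \<and>
       (\<forall>p \<in> {1..l}. T p = i \<and> (p = l \<or> T (p + 1) \<noteq> i + 1) \<longrightarrow>
          phi_acts_by t (extremal_action l act) \<epsilon> i (extremal_vec l (Some T))
            (psi t (a * exp t powi (i + l + 1 - 2 * p)))) \<and>
       ((\<nexists>p. p \<in> {1..l} \<and> T p = i + 1 \<and> (p = 1 \<or> T (p - 1) \<noteq> i)) \<and>
        (\<nexists>p. p \<in> {1..l} \<and> T p = i \<and> (p = l \<or> T (p + 1) \<noteq> i + 1)) \<longrightarrow>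
          phi_acts_by t (extremal_action l act) \<epsilon> i (extremal_vec l (Some T)) 1))"
proof (intro ballI allI)
  fix T and i :: int
  assume T: "T \<in> T_seg l"
  then have "T \<in> Pi_map l ` T_pairs l" using bij_Pi_map[OF assms(2)] by (simp add: bij_betw_def)
  then obtain S S' where pair: "(S, S') \<in> T_pairs l" and R: "Pi_map l (S, S') = T"
    by (metis imageE surj_pair)
  \<comment> \<open>The root-of-unity hypothesis enters at exponent 2.\<close>
  interpret drinfeld_pair l S S' t a act1 act2 act
    using assms(2-) assms(1)[THEN spec[of _ 2]] pair by unfold_locales simp_all
  note prev = in_image_prev[OF T] and succ = in_image_next[OF T]
  have v: "extremal_vec l (Some T) = basis_vec (S, S')"
    using extremal_vec_Pi_map[OF assms(2) pair] R by simp
  note ext = extremal_action_basis_vec[OF pair]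
  \<comment> \<open>Extends the sum over a fibre to all positions; \<open>of_bool\<close> kills the
    added terms.\<close>
  have sum_eq: "(\<Sum>p | p \<in> {1..l} \<and> T p = j. scale (delta (d p) r) w) =
      (\<Sum>p = 1..l. scale (of_bool (T p = j) * delta (d p) r) w)"
    for j d r and w :: "seq \<times> seq \<Rightarrow>\<^sub>0 complex"
    by (rule sum.mono_neutral_cong_left) auto
  have phi: "phi_rule t (extremal_action l act) {1..l} l a i T (basis_vec (S, S'))"
    using act_phi[of i] by (simp add: phi_rule_def phi_acts_by_def ext R)
  \<comment> \<open>The "otherwise" case: if neither neighbour condition holds, the presence of one
    of i and i + 1 forces that of the other.\<close>
  have none: "i \<in> T ` {1..l} \<longleftrightarrow> i + 1 \<in> T ` {1..l}"
    if "\<nexists>p. p \<in> {1..l} \<and> T p = i + 1 \<and> (p = 1 \<or> T (p - 1) \<noteq> i)"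
      "\<nexists>p. p \<in> {1..l} \<and> T p = i \<and> (p = l \<or> T (p + 1) \<noteq> i + 1)"
  proof
    assume "i \<in> T ` {1..l}"
    then obtain p where "p \<in> {1..l}" "T p = i" by auto
    then show "i + 1 \<in> T ` {1..l}" using succ[of p i] that(2) by blast
  next
    assume "i + 1 \<in> T ` {1..l}"
    then obtain p where "p \<in> {1..l}" "T p = i + 1" by auto
    then show "i \<in> T ` {1..l}" using prev[of p i] that(1) by blast
  qed
  show "(\<forall>r. extremal_action l act (x_coeff t Pos i r) (extremal_vec l (Some T)) =
        (\<Sum>p = 1..l. scale (of_bool (T p = i + 1) * delta (a * exp t powi (i + l + 1 - 2 * p)) r)
           (extremal_vec l (e_op {1..l} i T)))) \<and>
     (\<forall>r. extremal_action l act (x_coeff t Neg i r) (extremal_vec l (Some T)) =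
        (\<Sum>p = 1..l. scale (of_bool (T p = i) * delta (a * exp t powi (i + l + 1 - 2 * p)) r)
           (extremal_vec l (f_op {1..l} i T)))) \<and>
     (\<forall>\<epsilon>.
       (\<forall>p \<in> {1..l}. T p = i + 1 \<and> (p = 1 \<or> T (p - 1) \<noteq> i) \<longrightarrow>
          phi_acts_by t (extremal_action l act) \<epsilon> i (extremal_vec l (Some T))
            (inverse (psi t (a * exp t powi (i + l + 3 - 2 * p))))) \<and>
       (\<forall>p \<in> {1..l}. T p = i \<and> (p = l \<or> T (p + 1) \<noteq> i + 1) \<longrightarrow>
          phi_acts_by t (extremal_action l act) \<epsilon> i (extremal_vec l (Some T))
            (psi t (a * exp t powi (i + l + 1 - 2 * p)))) \<and>
       ((\<nexists>p. p \<in> {1..l} \<and> T p = i + 1 \<and> (p = 1 \<or> T (p - 1) \<noteq> i)) \<and>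
        (\<nexists>p. p \<in> {1..l} \<and> T p = i \<and> (p = l \<or> T (p + 1) \<noteq> i + 1)) \<longrightarrow>
          phi_acts_by t (extremal_action l act) \<epsilon> i (extremal_vec l (Some T)) 1))"
    unfolding v
  proof (intro conjI allI ballI impI, goal_cases)
    case (1 r)
    show ?case by (simp only: ext act_x_pos R sum_eq)
  next
    case (2 r)
    show ?case by (simp only: ext act_x_neg R sum_eq)
  next
    case (3 \<epsilon> p)
    then have "p \<in> {1..l}" "T p = i + 1" "i \<notin> T ` {1..l}" using prev[of p i] by blast+
    then show ?case by (rule phi_ruleD(1)[OF phi])
  next
    case (4 \<epsilon> p)
    then have "p \<in> {1..l}" "T p = i" "i + 1 \<notin> T ` {1..l}" using succ[of p i] by blast+
    then show ?case by (rule phi_ruleD(2)[OF phi])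
  next
    case (5 \<epsilon>)
    then have "i \<in> T ` {1..l} \<longleftrightarrow> i + 1 \<in> T ` {1..l}" using none by blast
    then show ?case by (rule phi_ruleD(3)[OF phi])
  qed
qed

end
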